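(* Let $1\le i\le k<n$ and let $\alpha_{i,n}$ be an arbitrary positive real number. The cdf $H$ of $\sigma^{-1}\alpha_{i,n}(\tilde\theta_{S,i}-\theta_i)$ under $P_{n,\theta,\sigma}$ is given by $$H(x)=\int_0^\infty\Phi\left(n^{1/2}x/(\alpha_{i,n}\xi_{i,n})+n^{1/2}s\eta_{i,n}\right)\rho_{n-k}(s)\,ds\,\mathbf{1}\left(\alpha_{i,n}^{-1}x+\theta_i/\sigma\ge0\right)$$ $$+\int_0^\infty\Phi\left(n^{1/2}x/(\alpha_{i,n}\xi_{i,n})-n^{1/2}s\eta_{i,n}\right)\rho_{n-k}(s)\,ds\,\mathbf{1}\left(\alpha_{i,n}^{-1}x+\theta_i/\sigma<0\right)$$ $$=T_{n-k,-n^{1/2}x/(\alpha_{i,n}\xi_{i,n})}\left(n^{1/2}\eta_{i,n}\right)\mathbf{1}\left(\alpha_{i,n}^{-1}x+\theta_i/\sigma\ge0\right)+T_{n-k,-n^{1/2}x/(\alpha_{i,n}\xi_{i,n})}\left(-n^{1/2}\eta_{i,n}\right)\mathbf{1}\left(\alpha_{i,n}^{-1}x+\theta_i/\sigma<0\right).$$ Or, equivalently, the corresponding measure is $$dH(x)=\int_0^\infty\left\{\Phi\left(n^{1/2}(-\theta_i/(\sigma\xi_{i,n})+s\eta_{i,n})\right)-\Phi\left(n^{1/2}(-\theta_i/(\sigma\xi_{i,n})-s\eta_{i,n})\right)\right\}\rho_{n-k}(s)\,ds\;d\delta_{-\alpha_{i,n}\theta_i/\sigma}(x)$$ $$+\,n^{1/2}\alpha_{i,n}^{-1}\xi_{i,n}^{-1}\Big\{\int_0^\infty\phi\left(n^{1/2}x/(\alpha_{i,n}\xi_{i,n})+n^{1/2}s\eta_{i,n}\right)\rho_{n-k}(s)\,ds\,\mathbf{1}\left(\alpha_{i,n}^{-1}x+\theta_i/\sigma>0\right)$$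 $$\qquad+\int_0^\infty\phi\left(n^{1/2}x/(\alpha_{i,n}\xi_{i,n})-n^{1/2}s\eta_{i,n}\right)\rho_{n-k}(s)\,ds\,\mathbf{1}\left(\alpha_{i,n}^{-1}x+\theta_i/\sigma<0\right)\Big\}dx,$$ where $\delta_z$ denotes pointmass at $z$.
   Context: Consider the linear regression model $Y=X\theta+u$, where $X$ is a nonstochastic $n\times k$ matrix of rank $k\ge1$ with $n>k$, $\theta\in\mathbb{R}^k$, $u\sim N(0,\sigma^2I_n)$, $0<\sigma<\infty$; $P_{n,\theta,\sigma}$ denotes probability under parameters $\theta,\sigma$. $X'$ is the transpose of $X$. $\xi_{i,n}$ is the nonnegative square root of the $i$-th diagonal element of $(X'X/n)^{-1}$. $\hat\theta_{LS}=(X'X)^{-1}X'Y$ with $i$-th component $\hat\theta_{LS,i}$, and $\hat\sigma^2=(n-k)^{-1}(Y-X\hat\theta_{LS})'(Y-X\hat\theta_{LS})$, $\hat\sigma\ge0$. The tuning parameter $\eta_{i,n}$ is a positive real number. The soft-thresholding estimator is $\tilde\theta_{S,i}=\mathrm{sign}(\hat\theta_{LS,i})(|\hat\theta_{LS,i}|-\hat\sigma\xi_{i,n}\eta_{i,n})_+$ with $(\cdot)_+=\max(\cdot,0)$. $\Phi,\phi$ are the standard normal cdf and pdf. $\rho_m$ is the density of $m^{-1/2}$ times the square root of a chi-square random variable with $m$ degrees of freedom. $T_{m,c}$ is the cdf of a non-central $T$-distribution with $m$ degrees of freedom and non-centrality parameter $c\in\mathbb{R}$. *)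

theory Defs
  imports "HOL-Probability.Probability"
begin

(* Density of N(mu, Sigma), for positive definite Sigma. *)
definition multivariate_normal_density ::
    "real ^ 'n \<Rightarrow> real ^ 'n ^ 'n \<Rightarrow> real ^ 'n \<Rightarrow> real" where
  "multivariate_normal_density \<mu> \<Sigma> x =
     exp (- ((x - \<mu>) \<bullet> (matrix_inv \<Sigma> *v (x - \<mu>))) / 2) /
     sqrt ((2 * pi) ^ CARD('n) * det \<Sigma>)"

definition std_normal_cdf :: "real \<Rightarrow> real" where
  "std_normal_cdf = cdf std_normal_distribution"

definition chi_square :: "nat \<Rightarrow> real measure" where
  "chi_square m =
     distr (\<Pi>\<^sub>M j\<in>{..<m}. std_normal_distribution) borel (\<lambda>z. \<Sum>j<m. (z j)\<^sup>2)"

(* A fixed version of the Lebesgue density of m^(-1/2) times the square root of a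
   chi-square variable with m degrees of freedom. That this law has a density for m > 0
   is the lemma distributed_root_chi_square below. *)
definition root_chi_square_density :: "nat \<Rightarrow> real \<Rightarrow> real" where
  "root_chi_square_density m s =
     enn2real (RN_deriv lborel (distr (chi_square m) borel (\<lambda>v. sqrt v / sqrt (real m))) s)"

(* The law of (Z + c) / sqrt (V / m), with Z standard normal and V chi-square with m degrees
   of freedom, independent of Z. *)
definition noncentral_t :: "nat \<Rightarrow> real \<Rightarrow> real measure" where
  "noncentral_t m c =
     distr (std_normal_distribution \<Otimes>\<^sub>M chi_square m) borel
       (\<lambda>(z, v). (z + c) / sqrt (v / real m))"

definition noncentral_t_cdf :: "nat \<Rightarrow> real \<Rightarrow> real \<Rightarrow> real" where
  "noncentral_t_cdf m c = cdf (noncentral_t m c)"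

(* The design matrix X has n rows and k columns, so its type is real ^ 'k ^ 'n. *)

definition ls_estimator :: "real ^ 'k ^ 'n \<Rightarrow> real ^ 'n \<Rightarrow> real ^ 'k" where
  "ls_estimator X y = matrix_inv (transpose X ** X) *v (transpose X *v y)"

definition sigma_hat :: "real ^ 'k ^ 'n \<Rightarrow> real ^ 'n \<Rightarrow> real" where
  "sigma_hat X y =
     sqrt (((y - X *v ls_estimator X y) \<bullet> (y - X *v ls_estimator X y)) /
           (real CARD('n) - real CARD('k)))"

definition xi :: "real ^ 'k ^ 'n \<Rightarrow> 'k \<Rightarrow> real" where
  "xi X i = sqrt (matrix_inv ((1 / real CARD('n)) *\<^sub>R (transpose X ** X)) $ i $ i)"

definition soft_threshold_estimator ::
    "real ^ 'k ^ 'n \<Rightarrow> real \<Rightarrow> real ^ 'n \<Rightarrow> 'k \<Rightarrow> real" where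
  "soft_threshold_estimator X \<eta> y i =
     sgn (ls_estimator X y $ i) *
     max (\<bar>ls_estimator X y $ i\<bar> - sigma_hat X y * xi X i * \<eta>) 0"

lemma prob_space_std_normal: "prob_space std_normal_distribution"
  using prob_space_normal_density[of 1 0] by simp

lemma sets_chi_square [simp, measurable_cong]: "sets (chi_square m) = sets borel"
  and space_chi_square [simp]: "space (chi_square m) = UNIV"
  by (simp_all add: chi_square_def)

lemma prob_space_chi_square: "prob_space (chi_square m)"
proof -
  interpret product_prob_space "\<lambda>j::nat. std_normal_distribution" "{..<m}"
    by (simp add: product_prob_space_def product_prob_space_axioms_def
        product_sigma_finite_def prob_space_std_normal prob_space_imp_sigma_finite)
  show ?thesis
    unfolding chi_square_def by (rule prob_space_distr) measurable
qed

lemma negligible_root_shift_vimage: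
  fixes N :: "real set"
  assumes N: "negligible N" and m: "m > 0" and c: "c \<ge> 0"
  shows "negligible {x. sqrt (x\<^sup>2 + c) / sqrt m \<in> N}"
proof -
  define S where "S = {s \<in> N. m * s\<^sup>2 - c > 0}"
  define h where "h = (\<lambda>s. sqrt (m * s\<^sup>2 - c))"
  have S: "negligible S"
    using N by (rule negligible_subset) (auto simp: S_def)
  have "(h has_real_derivative (m * (2 * s)) * (inverse (sqrt (m * s\<^sup>2 - c)) / 2)) (at s)"
    if "s \<in> S" for s
    using that unfolding h_def S_def
    by (auto intro!: derivative_eq_intros)
  then have h: "h differentiable_on S"
    by (metis differentiable_at_imp_differentiable_on real_differentiable_def)
  have neg: "negligible (h ` S \<union> (\<lambda>s. - h s) ` S \<union> {0})"
    using S h differentiable_on_minus[OF h]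
    by (intro negligible_Un negligible_differentiable_image_negligible) auto
  show ?thesis
  proof (rule negligible_subset[OF neg], rule subsetI)
    fix x assume "x \<in> {x. sqrt (x\<^sup>2 + c) / sqrt m \<in> N}"
    then have x: "sqrt (x\<^sup>2 + c) / sqrt m \<in> N" (is "?s \<in> N") by simp
    have eq: "m * ?s\<^sup>2 - c = x\<^sup>2"
      using m c by (simp add: power_divide)
    have "?s \<in> S" if "x \<noteq> 0"
      unfolding S_def mem_Collect_eq eq using x that by simp
    moreover have "h ?s = \<bar>x\<bar>"
      unfolding h_def eq by simp
    ultimately show "x \<in> h ` S \<union> (\<lambda>s. - h s) ` S \<union> {0}"
      by (cases "x \<ge> 0"; cases "x = 0") (force simp: image_iff)+
  qed
qed

lemma absolutely_continuous_root_chi_square: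
  assumes "m > 0"
  shows "absolutely_continuous lborel (distr (chi_square m) borel (\<lambda>v. sqrt v / sqrt (real m)))"
  unfolding absolutely_continuous_def
proof
  interpret product_sigma_finite "\<lambda>j::nat. std_normal_distribution"
    by (simp add: product_sigma_finite_def prob_space_std_normal prob_space_imp_sigma_finite)
  fix N :: "real set" assume N: "N \<in> null_sets lborel"
  then have [measurable]: "N \<in> sets borel" by auto
  have neg: "negligible N"
    using N by (simp add: negligible_iff_null_sets null_sets_completionI)
  obtain k where k: "m = Suc k" using assms not0_implies_Suc by blast
  let ?f = "\<lambda>z :: nat \<Rightarrow> real. indicator N (sqrt (\<Sum>j<m. (z j)\<^sup>2) / sqrt (real m)) :: ennreal"
  have inner: "(\<integral>\<^sup>+ y. ?f (z(k := y)) \<partial>std_normal_distribution) = 0" for z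
  proof -
    let ?c = "\<Sum>j<k. (z j)\<^sup>2"
    have "(\<Sum>j<k. ((z(k := y)) j)\<^sup>2) = ?c" for y
      by (rule sum.cong) auto
    then have f: "?f (z(k := y)) = indicator {x. sqrt (x\<^sup>2 + ?c) / sqrt (real m) \<in> N} y" for y
      by (simp add: k indicator_def add.commute)
    let ?B = "{x. sqrt (x\<^sup>2 + ?c) / sqrt (real m) \<in> N}"
    have B: "?B \<in> sets borel" by measurable
    have "negligible ?B"
      using neg assms by (intro negligible_root_shift_vimage) (auto intro: sum_nonneg)
    then have "emeasure lborel ?B = 0"
      using B by (simp add: negligible_iff_emeasure0)
    then have "?B \<in> null_sets lborel" using B by auto
    then have "?B \<in> null_sets std_normal_distribution"
      by (auto simp: null_sets_density_iff dest: AE_not_in)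
    then show ?thesis
      unfolding f using B by auto
  qed
  have "emeasure (distr (chi_square m) borel (\<lambda>v. sqrt v / sqrt (real m))) N
      = (\<integral>\<^sup>+ z. ?f z \<partial>(\<Pi>\<^sub>M j\<in>{..<m}. std_normal_distribution))"
    by (simp add: nn_integral_distr chi_square_def flip: nn_integral_indicator)
  also have "\<dots> = (\<integral>\<^sup>+ z. ?f z \<partial>(\<Pi>\<^sub>M j\<in>insert k {..<k}. std_normal_distribution))"
    by (simp add: k lessThan_Suc)
  also have "\<dots> = (\<integral>\<^sup>+ z. (\<integral>\<^sup>+ y. ?f (z(k := y)) \<partial>std_normal_distribution)
      \<partial>(\<Pi>\<^sub>M j\<in>{..<k}. std_normal_distribution))"
    by (intro product_nn_integral_insert) (auto simp: k lessThan_Suc[symmetric] simp del: sum.lessThan_Suc)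
  also have "\<dots> = 0"
    unfolding inner by simp
  finally show "N \<in> null_sets (distr (chi_square m) borel (\<lambda>v. sqrt v / sqrt (real m)))"
    by auto
qed

lemma distributed_root_chi_square:
  assumes "m > 0"
  shows "distributed (chi_square m) lborel (\<lambda>v. sqrt v / sqrt (real m))
           (\<lambda>s. ennreal (root_chi_square_density m s))"
proof -
  let ?D = "distr (chi_square m) borel (\<lambda>v. sqrt v / sqrt (real m))"
  interpret C: prob_space "chi_square m" by (rule prob_space_chi_square)
  interpret D: prob_space ?D by (rule C.prob_space_distr) simp
  have ac: "absolutely_continuous lborel ?D"
    using assms by (rule absolutely_continuous_root_chi_square)
  have "AE s in lborel. RN_deriv lborel ?D s \<noteq> \<infinity>"
    by (rule sigma_finite_measure.RN_deriv_finite[OF sigma_finite_lborel _ ac])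
      (simp_all add: D.sigma_finite_measure_axioms)
  then have "AE s in lborel. RN_deriv lborel ?D s = ennreal (root_chi_square_density m s)"
    by eventually_elim (simp add: root_chi_square_density_def less_top)
  moreover have [measurable]: "root_chi_square_density m \<in> borel_measurable borel"
    unfolding root_chi_square_density_def by measurable
  ultimately have "density lborel (\<lambda>s. ennreal (root_chi_square_density m s))
      = density lborel (RN_deriv lborel ?D)"
    by (intro density_cong) (auto elim: eventually_mono)
  also have "\<dots> = ?D"
    by (rule sigma_finite_measure.density_RN_deriv[OF sigma_finite_lborel ac]) simp
  finally have "distr (chi_square m) lborel (\<lambda>v. sqrt v / sqrt (real m))
      = density lborel (\<lambda>s. ennreal (root_chi_square_density m s))"
    by (simp cong: distr_cong)
  then show ?thesis
    by (simp add: distributed_def)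
qed

end

theory Submission
  imports Defs
begin

text \<open>Write \<open>r\<close> for the square root of \<open>n\<close>. Everything the estimator sees of the data is the pair
consisting of the least squares coordinate and the residual variance. Both are functions of
orthonormal coordinates of the error vector: the coordinate error is \<open>u \<bullet> v\<close> for a vector \<open>v\<close> in the
column space of the design matrix whose length is \<open>\<xi> / r\<close>, and the residual sum of squares is the
sum of the squared coordinates of \<open>u\<close> along an orthonormal basis of the orthogonal complement of
that column space (\<open>least_squares_decomposition\<close>). A spherical normal vector has independent
normal coordinates in every orthonormal system, so after division by \<open>\<sigma>\<close> the pair becomes
\<open>(Z, V)\<close> with \<open>Z\<close> standard normal, \<open>V\<close> chi-square with \<open>m\<close> degrees of freedom, and \<open>Z\<close>, \<open>V\<close>
independent (\<open>joint_law_std_gaussian_coordinate_sum_squares\<close>).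

Soft thresholding commutes with positive scaling. With \<open>S = sqrt (V / m)\<close>, \<open>d = \<alpha> \<xi> / r\<close>,
\<open>a = r \<eta>\<close> and \<open>\<tau> = r \<theta>\<^sub>i / (\<sigma> \<xi>)\<close>, the scaled estimation error therefore has the law of
\<open>d (soft (a S) (\<tau> + Z) - \<tau>)\<close>, where \<open>soft c b\<close> shrinks \<open>b\<close> towards zero by \<open>c\<close>
(\<open>distr_soft_threshold_error\<close>).

Given \<open>S = s\<close>, this is a piecewise affine function of one normal variable. It is at most \<open>x\<close> exactly
when \<open>Z \<le> x / d + a s\<close> or \<open>Z \<le> x / d - a s\<close>, depending on the sign of \<open>x / d + \<tau>\<close>. The interval on
which it is constant produces the atom, and the two affine pieces produce the density. Integrating
over the law of \<open>S\<close> gives both the distribution function and the measure. The noncentral t form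
follows because \<open>(Z + c) / S \<le> t\<close> means \<open>Z \<le> t S - c\<close>.\<close>

section \<open>Invariance of Lebesgue measure under isometries\<close>

text \<open>A double integral over a set \<open>A\<close> and the unit ball, evaluated in the two possible orders, shows that
the push-forward of Lebesgue measure under the isometry is proportional to Lebesgue measure: only
translation and reflection invariance of the latter enter. The factor is 1 because a linear
isometry maps the unit ball onto itself.\<close>

lemma distr_lborel_orthogonal_transformation:
  fixes T :: "'a::euclidean_space \<Rightarrow> 'a"
  assumes T: "orthogonal_transformation T"
  shows "distr lborel borel T = lborel"
proof (rule measure_eqI)
  have lin: "linear T" using T by (rule orthogonal_transformation_linear)
  have [measurable]: "T \<in> borel_measurable borel"
    using lin by (intro borel_measurable_continuous_onI linear_continuous_on linear_conv_bounded_linear[THEN iffD1])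
  fix A :: "'a set" assume "A \<in> sets (distr lborel borel T)"
  then have A[measurable]: "A \<in> sets borel" by simp
  define B :: "'a set" where "B = ball 0 1"
  have B[measurable]: "B \<in> sets borel" by (simp add: B_def)
  have TB: "T x \<in> B \<longleftrightarrow> x \<in> B" for x
    using T by (simp add: B_def orthogonal_transformation)
  have shift: "(\<integral>\<^sup>+ x. f (t + x) \<partial>lborel) = (\<integral>\<^sup>+ x. f x \<partial>lborel)"
    if "f \<in> borel_measurable borel" for f :: "'a \<Rightarrow> ennreal" and t
    using that nn_integral_distr[of "(+) t" lborel borel f] by (simp add: lborel_distr_plus)
  have reflect: "(\<integral>\<^sup>+ x. f (t - x) \<partial>lborel) = (\<integral>\<^sup>+ x. f x \<partial>lborel)"
    if [measurable]: "f \<in> borel_measurable borel" for f :: "'a \<Rightarrow> ennreal" and t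
    using lborel_affine[of "-1" t] nn_integral_distr[of "\<lambda>x. t - x" lborel borel f] 
    by (simp add: density_1)
  let ?l = "\<lambda>S. emeasure lborel (S :: 'a set)"
  \<comment> \<open>The two factors are merged into one double integral by translating the ball by \<open>T x\<close>.\<close>
  have "?l (T -` A) * ?l B = (\<integral>\<^sup>+ x. indicator A (T x) * ?l B \<partial>lborel)"
  proof -
    have "T -` A \<in> sets lborel" using measurable_sets[of T borel borel A] by simp
    then show ?thesis by (simp add: nn_integral_multc flip: indicator_vimage)
  qed
  also have "\<dots> = (\<integral>\<^sup>+ x. \<integral>\<^sup>+ y. indicator A (T x) * indicator B (T x + y) \<partial>lborel \<partial>lborel)"
    by (simp add: nn_integral_cmult shift[of "indicator B"])
  also have "\<dots> = (\<integral>\<^sup>+ y. \<integral>\<^sup>+ x. indicator A (T x) * indicator B (T x + y) \<partial>lborel \<partial>lborel)"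
    by (rule lborel_pair.Fubini') measurable
  also have "\<dots> = (\<integral>\<^sup>+ y. \<integral>\<^sup>+ x. indicator A (T x - y) * indicator B (T x) \<partial>lborel \<partial>lborel)"
  proof (rule nn_integral_cong)
    fix y
    obtain t where t: "y = T t" using orthogonal_transformation_surj[OF T] by (metis surjD)
    \<comment> \<open>Translating the inner variable by a preimage of \<open>y\<close> moves \<open>y\<close> from the ball to \<open>A\<close>.\<close>
    have "T (- t + x) = T x - y" for x
      using lin by (simp add: t linear_diff)
    then show "(\<integral>\<^sup>+ x. indicator A (T x) * indicator B (T x + y) \<partial>lborel)
        = (\<integral>\<^sup>+ x. indicator A (T x - y) * indicator B (T x) \<partial>lborel)"
      using shift[of "\<lambda>x. indicator A (T x) * indicator B (T x + y)" "- t"] by simp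
  qed
  also have "\<dots> = (\<integral>\<^sup>+ x. \<integral>\<^sup>+ y. indicator A (T x - y) * indicator B (T x) \<partial>lborel \<partial>lborel)"
    by (rule lborel_pair.Fubini') measurable
  also have "\<dots> = (\<integral>\<^sup>+ x. ?l A * indicator B x \<partial>lborel)"
  proof -
    have "indicator B (T x) = (indicator B x :: ennreal)" for x
      by (simp add: TB indicator_def)
    then show ?thesis by (simp add: nn_integral_multc reflect[of "indicator A"])
  qed
  also have "\<dots> = ?l A * ?l B"
    by (simp add: nn_integral_cmult)
  finally have "?l (T -` A) * ?l B = ?l A * ?l B" .
  moreover have "?l B \<noteq> 0" "?l B \<noteq> \<top>"
    using emeasure_lborel_ball_finite[of "0::'a" 1] content_ball_pos[of 1 "0::'a"]
    by (auto simp: B_def measure_def)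
  ultimately show "emeasure (distr lborel borel T) A = emeasure lborel A"
    by (simp add: emeasure_distr ennreal_mult_cancel_left mult.commute[of _ "emeasure lborel B"])
qed simp

section \<open>The standard Gaussian measure and orthonormal coordinates\<close>

definition std_gaussian :: "'a::euclidean_space measure" where
  "std_gaussian = density lborel (\<lambda>x. \<Prod>b\<in>Basis. ennreal (std_normal_density (x \<bullet> b)))"

lemma sets_std_gaussian [simp, measurable_cong]: "sets std_gaussian = sets borel"
  and space_std_gaussian [simp]: "space std_gaussian = UNIV"
  by (simp_all add: std_gaussian_def)

lemma prod_std_normal_density:
  assumes "finite B"
  shows "(\<Prod>b\<in>B. std_normal_density (f b)) =
    exp (- (\<Sum>b\<in>B. (f b)\<^sup>2) / 2) / sqrt ((2 * pi) ^ card B)"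
proof -
  have "(\<Prod>b\<in>B. std_normal_density (f b)) = (\<Prod>b\<in>B. exp (- (f b)\<^sup>2 / 2) / sqrt (2 * pi))"
    by (simp add: std_normal_density_def)
  also have "\<dots> = (\<Prod>b\<in>B. exp (- (f b)\<^sup>2 / 2)) / sqrt (2 * pi) ^ card B"
    by (simp add: prod_dividef)
  also have "(\<Prod>b\<in>B. exp (- (f b)\<^sup>2 / 2)) = exp (- (\<Sum>b\<in>B. (f b)\<^sup>2) / 2)"
    using assms by (simp flip: exp_sum add: sum_negf sum_divide_distrib)
  finally show ?thesis by (simp only: real_sqrt_power)
qed

lemma norm_square_eq_sum_Basis: "(norm x)\<^sup>2 = (\<Sum>b\<in>Basis. (x \<bullet> b)\<^sup>2)"
  by (subst power2_norm_eq_inner, subst euclidean_inner) (simp add: power2_eq_square)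

lemma std_gaussian_eq_density_norm:
  "std_gaussian = density lborel (\<lambda>x :: 'a::euclidean_space.
     ennreal (exp (- (norm x)\<^sup>2 / 2) / sqrt ((2 * pi) ^ DIM('a))))"
  unfolding std_gaussian_def
  by (simp add: prod_ennreal prod_std_normal_density norm_square_eq_sum_Basis)

lemma product_prob_space_std_normal: "product_prob_space (\<lambda>b. std_normal_distribution)"
  by (simp add: product_prob_space_def product_prob_space_axioms_def
      product_sigma_finite_def prob_space_std_normal prob_space_imp_sigma_finite)

text \<open>For the standard basis independence is the product form of the density. An orthonormal basis is the
image of the standard one under an isometry, and the density depends on the norm only, so the
isometry changes neither the density nor Lebesgue measure.\<close>

lemma coordinates_std_gaussian_orthonormal_basis:
  fixes B :: "'a::euclidean_space set"
  assumes orth: "pairwise orthogonal B" and norm: "\<And>b. b \<in> B \<Longrightarrow> norm b = 1"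
    and card: "card B = DIM('a)"
  shows "distr std_gaussian (\<Pi>\<^sub>M b\<in>B. std_normal_distribution) (\<lambda>x. \<lambda>b\<in>B. x \<bullet> b)
    = (\<Pi>\<^sub>M b\<in>B. std_normal_distribution)" (is "?D = _")
proof -
  interpret product_prob_space "\<lambda>b::'a. std_normal_distribution" B
    by (rule product_prob_space_std_normal)
  have fin: "finite B" using card DIM_positive card_ge_0_finite by metis
  obtain \<beta> where \<beta>: "bij_betw \<beta> (Basis :: 'a set) B"
    using card fin finite_same_card_bij[OF finite_Basis fin] by auto
  define T where "T x = (\<Sum>b\<in>Basis. (x \<bullet> b) *\<^sub>R \<beta> b)" for x
  have inner_\<beta>: "\<beta> b \<bullet> \<beta> c = (if b = c then 1 else 0)" if "b \<in> Basis" "c \<in> Basis" for b c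
  proof (cases "b = c")
    case True
    then show ?thesis using norm[of "\<beta> b"] \<beta> that by (auto simp: bij_betw_def norm_eq_1)
  next
    case False
    then have "\<beta> b \<noteq> \<beta> c" using \<beta> that by (auto simp: bij_betw_def inj_on_def)
    then show ?thesis using False orth \<beta> that
      by (auto simp: bij_betw_def pairwise_def orthogonal_def)
  qed
  have T_\<beta>: "T x \<bullet> \<beta> c = x \<bullet> c" if "c \<in> Basis" for x c
    using that by (simp add: T_def inner_sum_left inner_\<beta> if_distrib cong: if_cong)
  have lin: "linear T"
    unfolding T_def by (intro linear_sum linearI) (auto simp: algebra_simps sum.distrib scaleR_sum_right)
  have "norm (T x) = norm x" for x
  proof -
    have "T x \<bullet> T x = (\<Sum>c\<in>Basis. (x \<bullet> c) * (T x \<bullet> \<beta> c))"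
      by (simp add: T_def[of x] inner_sum_right) 
    also have "\<dots> = x \<bullet> x"
      by (simp add: T_\<beta> euclidean_inner[of x x])
    finally show ?thesis by (simp add: norm_eq_sqrt_inner)
  qed
  then have T: "orthogonal_transformation T"
    using lin by (simp add: orthogonal_transformation)
  have [measurable]: "T \<in> borel_measurable borel"
    using lin by (intro borel_measurable_continuous_onI linear_continuous_on linear_conv_bounded_linear[THEN iffD1])
  show ?thesis
  proof (rule PiM_eqI)
    fix A :: "'a \<Rightarrow> real set" assume A: "\<And>b. b \<in> B \<Longrightarrow> A b \<in> sets std_normal_distribution"
    then have A'[measurable]: "\<beta> b \<in> B \<Longrightarrow> A (\<beta> b) \<in> sets borel" for b by simp
    have \<beta>B: "b \<in> Basis \<Longrightarrow> \<beta> b \<in> B" for b using \<beta> by (auto simp: bij_betw_def)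
    let ?g = "\<lambda>x::'a. ennreal (exp (- (norm x)\<^sup>2 / 2) / sqrt ((2 * pi) ^ DIM('a)))"
    let ?S = "{x::'a. \<forall>b\<in>B. x \<bullet> b \<in> A b}"
    have S[measurable]: "?S \<in> sets borel"
    proof -
      have "?S = (\<Inter>b\<in>B. (\<lambda>x. x \<bullet> b) -` A b \<inter> space borel)" by auto
      moreover have "(\<lambda>x. x \<bullet> b) -` A b \<inter> space borel \<in> sets borel" if "b \<in> B" for b
        using A[OF that] by (intro measurable_sets[of _ _ borel]) auto
      moreover have "B \<noteq> {}" using card by force
      ultimately show ?thesis using fin by auto
    qed
    have "emeasure ?D (Pi\<^sub>E B A) = emeasure std_gaussian ?S"
      using A fin by (subst emeasure_distr) (auto intro!: sets_PiM_I_finite arg_cong2[where f=emeasure] simp: PiE_iff)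
    also have "\<dots> = (\<integral>\<^sup>+ x. ?g x * indicator ?S x \<partial>lborel)"
      by (simp add: std_gaussian_eq_density_norm emeasure_density)
    also have "\<dots> = (\<integral>\<^sup>+ x. ?g (T x) * indicator ?S (T x) \<partial>lborel)"
      by (subst distr_lborel_orthogonal_transformation[OF T, symmetric], subst nn_integral_distr) auto
    also have "\<dots> = (\<integral>\<^sup>+ x. (\<Prod>b\<in>Basis. ennreal (std_normal_density (x \<bullet> b)) * indicator (A (\<beta> b)) (x \<bullet> b)) \<partial>lborel)"
    proof (rule nn_integral_cong)
      fix x
      have "?g (T x) = (\<Prod>b\<in>Basis. ennreal (std_normal_density (x \<bullet> b)))"
        using T by (simp add: orthogonal_transformation prod_ennreal prod_std_normal_density norm_square_eq_sum_Basis)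
      moreover have "T x \<in> ?S \<longleftrightarrow> (\<forall>b\<in>Basis. x \<bullet> b \<in> A (\<beta> b))"
        using \<beta> by (auto simp: bij_betw_def T_\<beta>)
      then have "indicator ?S (T x) = (\<Prod>b\<in>Basis. indicator (A (\<beta> b)) (x \<bullet> b) :: ennreal)"
        by (auto simp: indicator_def)
      ultimately show "?g (T x) * indicator ?S (T x) = 
        (\<Prod>b\<in>Basis. ennreal (std_normal_density (x \<bullet> b)) * indicator (A (\<beta> b)) (x \<bullet> b))"
        by (simp add: prod.distrib)
    qed
    also have "\<dots> = (\<Prod>b\<in>Basis. \<integral>\<^sup>+ y. ennreal (std_normal_density y) * indicator (A (\<beta> b)) y \<partial>lborel)"
      using \<beta>B by (intro nn_integral_lborel_prod) auto
    also have "\<dots> = (\<Prod>b\<in>Basis. emeasure std_normal_distribution (A (\<beta> b)))"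
      using \<beta>B by (intro prod.cong refl) (simp add: emeasure_density)
    also have "\<dots> = (\<Prod>b\<in>B. emeasure std_normal_distribution (A b))"
      using \<beta> by (rule prod.reindex_bij_betw)
    finally show "emeasure ?D (Pi\<^sub>E B A) = (\<Prod>b\<in>B. emeasure std_normal_distribution (A b))" .
  qed (use fin in simp_all)
qed


text \<open>An orthonormal system extends to an orthonormal basis by one of the orthogonal complement of its
span; the additional coordinates are integrated out.\<close>

lemma coordinates_std_gaussian_orthonormal:
  fixes E :: "'a::euclidean_space set"
  assumes orth: "pairwise orthogonal E" and norm: "\<And>b. b \<in> E \<Longrightarrow> norm b = 1"
  shows "distr std_gaussian (\<Pi>\<^sub>M b\<in>E. std_normal_distribution) (\<lambda>x. \<lambda>b\<in>E. x \<bullet> b)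
    = (\<Pi>\<^sub>M b\<in>E. std_normal_distribution)"
proof -
  define C where "C = {y \<in> UNIV. \<forall>x\<in>span E. orthogonal x y}"
  have "subspace C"
    by (auto simp: C_def subspace_def orthogonal_clauses)
  then obtain F where F: "F \<subseteq> C" "pairwise orthogonal F"
    "\<And>x. x \<in> F \<Longrightarrow> norm x = 1" "independent F" "card F = dim C"
    using orthonormal_basis_subspace by metis
  have "0 \<notin> E" using norm by force
  then have indep: "independent E" using orth by (rule pairwise_orthogonal_independent[rotated])
  have FE: "orthogonal x y" if "x \<in> E" "y \<in> F" for x y
    using F(1) that by (auto simp: C_def intro: span_base)
  have "E \<inter> F = {}"
    using FE norm by (force simp: orthogonal_def norm_eq_1)
  moreover have fin: "finite E" "finite F" using indep F(4) by (auto dest: independent_imp_finite)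
  ultimately have "card (E \<union> F) = card E + card F" by (intro card_Un_disjoint) auto
  also have "\<dots> = DIM('a)"
    using dim_subspace_orthogonal_to_vectors[of "span E" UNIV] F(5) indep
    by (simp add: C_def dim_eq_card_independent)
  finally have card: "card (E \<union> F) = DIM('a)" .
  have orth': "pairwise orthogonal (E \<union> F)"
    using orth F(2) FE FE[THEN orthogonal_commute[THEN iffD1]] by (auto simp: pairwise_def)
  interpret product_prob_space "\<lambda>b::'a. std_normal_distribution" "E \<union> F"
    by (rule product_prob_space_std_normal)
  let ?P = "\<lambda>I::'a set. \<Pi>\<^sub>M b\<in>I. std_normal_distribution"
  have "?P E = distr (?P (E \<union> F)) (?P E) (\<lambda>x. restrict x E)"
    using fin by (intro distr_PiM_restrict_finite[symmetric]) auto
  also have "?P (E \<union> F) = distr std_gaussian (?P (E \<union> F)) (\<lambda>x. \<lambda>b\<in>E \<union> F. x \<bullet> b)"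
    using norm F(3) by (intro coordinates_std_gaussian_orthonormal_basis[symmetric] orth' card) auto
  also have "distr (distr std_gaussian (?P (E \<union> F)) (\<lambda>x. \<lambda>b\<in>E \<union> F. x \<bullet> b)) (?P E) (\<lambda>x. restrict x E)
      = distr std_gaussian (?P E) (\<lambda>x. \<lambda>b\<in>E. x \<bullet> b)"
  proof (subst distr_distr)
    show "(\<lambda>x. restrict x E) \<in> ?P (E \<union> F) \<rightarrow>\<^sub>M ?P E"
      by (rule measurable_restrict_subset) auto
    show "(\<lambda>x. \<lambda>b\<in>E \<union> F. x \<bullet> b) \<in> std_gaussian \<rightarrow>\<^sub>M ?P (E \<union> F)"
      by measurable
    show "distr std_gaussian (?P E) ((\<lambda>x. restrict x E) \<circ> (\<lambda>x. \<lambda>b\<in>E \<union> F. x \<bullet> b))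
      = distr std_gaussian (?P E) (\<lambda>x. \<lambda>b\<in>E. x \<bullet> b)"
      by (intro distr_cong) (auto simp: restrict_def)
  qed
  finally show ?thesis by simp
qed

text \<open>Frees the chi-square law from its index set \<open>{..<m}\<close>, so that the summands can be indexed by the
vectors of an orthonormal system.\<close>

lemma chi_square_eq_distr_sum_squares:
  assumes "finite E"
  shows "chi_square (card E) =
    distr (\<Pi>\<^sub>M b\<in>E. std_normal_distribution) borel (\<lambda>z. \<Sum>b\<in>E. (z b)\<^sup>2)"
proof -
  obtain h where h: "bij_betw h {..<card E} E"
    using assms ex_bij_betw_nat_finite[of E] by (auto simp: atLeast0LessThan)
  let ?I = "\<Pi>\<^sub>M j\<in>{..<card E}. std_normal_distribution"
  have "?I = distr (\<Pi>\<^sub>M b\<in>E. std_normal_distribution) ?I (\<lambda>z. \<lambda>j\<in>{..<card E}. z (h j))"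
    using h by (intro distr_PiM_reindex[symmetric])
      (auto simp: prob_space_std_normal bij_betw_def)
  then have "chi_square (card E) = distr (distr (\<Pi>\<^sub>M b\<in>E. std_normal_distribution) ?I
      (\<lambda>z. \<lambda>j\<in>{..<card E}. z (h j))) borel (\<lambda>z. \<Sum>j<card E. (z j)\<^sup>2)"
    by (simp add: chi_square_def)
  also have "\<dots> = distr (\<Pi>\<^sub>M b\<in>E. std_normal_distribution) borel (\<lambda>z. \<Sum>j<card E. (z (h j))\<^sup>2)"
  proof (subst distr_distr)
    show "(\<lambda>z. \<lambda>j\<in>{..<card E}. z (h j)) \<in> (\<Pi>\<^sub>M b\<in>E. std_normal_distribution) \<rightarrow>\<^sub>M ?I"
      using h by (intro measurable_restrict measurable_component_singleton) (auto simp: bij_betw_def)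
  qed (auto simp: o_def)
  also have "\<dots> = distr (\<Pi>\<^sub>M b\<in>E. std_normal_distribution) borel (\<lambda>z. \<Sum>b\<in>E. (z b)\<^sup>2)"
    using h by (intro distr_cong refl sum.reindex_bij_betw)
  finally show ?thesis .
qed

text \<open>The coordinate along \<open>w\<close> and the sum of squares involve disjoint sets of independent coordinates.\<close>

lemma joint_law_std_gaussian_coordinate_sum_squares:
  fixes E :: "'a::euclidean_space set"
  assumes orth: "pairwise orthogonal (insert w E)" and norm: "\<And>b. b \<in> insert w E \<Longrightarrow> norm b = 1"
    and "w \<notin> E"
  shows "distr std_gaussian (borel \<Otimes>\<^sub>M borel) (\<lambda>x. (x \<bullet> w, \<Sum>b\<in>E. (x \<bullet> b)\<^sup>2))
    = std_normal_distribution \<Otimes>\<^sub>M chi_square (card E)"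
proof -
  interpret product_prob_space "\<lambda>b::'a. std_normal_distribution" "insert w E"
    by (rule product_prob_space_std_normal)
  interpret N: prob_space std_normal_distribution by (rule prob_space_std_normal)
  interpret C: prob_space "chi_square (card E)" by (rule prob_space_chi_square)
  have "0 \<notin> insert w E" using norm by force
  then have "independent (insert w E)" using orth by (rule pairwise_orthogonal_independent[rotated])
  then have fin: "finite E" by (auto dest: independent_imp_finite)
  let ?P = "\<lambda>I::'a set. \<Pi>\<^sub>M b\<in>I. std_normal_distribution"
  let ?h = "\<lambda>z. (z w, \<Sum>b\<in>E. (z b)\<^sup>2) :: real \<times> real"
  have h: "?h \<in> ?P (insert w E) \<rightarrow>\<^sub>M borel \<Otimes>\<^sub>M borel"
    by measurable
  have "distr std_gaussian (borel \<Otimes>\<^sub>M borel) (\<lambda>x. (x \<bullet> w, \<Sum>b\<in>E. (x \<bullet> b)\<^sup>2))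
      = distr (distr std_gaussian (?P (insert w E)) (\<lambda>x. \<lambda>b\<in>insert w E. x \<bullet> b)) (borel \<Otimes>\<^sub>M borel) ?h"
  proof (subst distr_distr[OF h])
    show "(\<lambda>x. \<lambda>b\<in>insert w E. x \<bullet> b) \<in> std_gaussian \<rightarrow>\<^sub>M ?P (insert w E)"
      by measurable
    have "?h (\<lambda>b\<in>insert w E. x \<bullet> b) = (x \<bullet> w, \<Sum>b\<in>E. (x \<bullet> b)\<^sup>2)" for x
      by (auto intro: sum.cong)
    then show "distr std_gaussian (borel \<Otimes>\<^sub>M borel) (\<lambda>x. (x \<bullet> w, \<Sum>b\<in>E. (x \<bullet> b)\<^sup>2))
        = distr std_gaussian (borel \<Otimes>\<^sub>M borel) (?h \<circ> (\<lambda>x. \<lambda>b\<in>insert w E. x \<bullet> b))"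
      by (simp only: o_def)
  qed
  also have "\<dots> = distr (?P (insert w E)) (borel \<Otimes>\<^sub>M borel) ?h"
    by (simp only: coordinates_std_gaussian_orthonormal[OF orth norm])
  also have "\<dots> = std_normal_distribution \<Otimes>\<^sub>M chi_square (card E)"
  proof (rule pair_measure_eqI[symmetric])
    show "sets (std_normal_distribution \<Otimes>\<^sub>M chi_square (card E)) = sets (distr (?P (insert w E)) (borel \<Otimes>\<^sub>M borel) ?h)"
      by (simp cong: sets_pair_measure_cong)
    fix A C assume "A \<in> sets std_normal_distribution" "C \<in> sets (chi_square (card E))"
    then have [measurable]: "A \<in> sets borel" "C \<in> sets borel" by auto
    have "emeasure (distr (?P (insert w E)) (borel \<Otimes>\<^sub>M borel) ?h) (A \<times> C)
        = (\<integral>\<^sup>+ z. indicator A (z w) * indicator C (\<Sum>b\<in>E. (z b)\<^sup>2) \<partial>?P (insert w E))"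
    proof -
      have "emeasure (distr (?P (insert w E)) (borel \<Otimes>\<^sub>M borel) ?h) (A \<times> C)
          = (\<integral>\<^sup>+ p. indicator (A \<times> C) p \<partial>distr (?P (insert w E)) (borel \<Otimes>\<^sub>M borel) ?h)"
        by (rule nn_integral_indicator[symmetric]) simp
      also have "\<dots> = (\<integral>\<^sup>+ z. indicator (A \<times> C) (?h z) \<partial>?P (insert w E))"
        by (rule nn_integral_distr[OF h]) simp
      finally show ?thesis by (simp only: indicator_times fst_conv snd_conv)
    qed
    also have "\<dots> = (\<integral>\<^sup>+ z. (\<integral>\<^sup>+ y. indicator A ((z(w := y)) w) * indicator C (\<Sum>b\<in>E. ((z(w := y)) b)\<^sup>2)
        \<partial>std_normal_distribution) \<partial>?P E)"
      using fin \<open>w \<notin> E\<close> by (intro product_nn_integral_insert) auto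
    also have "\<dots> = (\<integral>\<^sup>+ z. (\<integral>\<^sup>+ y. indicator A y * indicator C (\<Sum>b\<in>E. (z b)\<^sup>2)
        \<partial>std_normal_distribution) \<partial>?P E)"
    proof -
      have "(\<Sum>b\<in>E. ((z(w := y)) b)\<^sup>2) = (\<Sum>b\<in>E. (z b)\<^sup>2)" for z :: "'a \<Rightarrow> real" and y
        using \<open>w \<notin> E\<close> by (intro sum.cong) auto
      then show ?thesis by (simp only: fun_upd_same)
    qed
    also have "\<dots> = (\<integral>\<^sup>+ z. emeasure std_normal_distribution A * indicator C (\<Sum>b\<in>E. (z b)\<^sup>2) \<partial>?P E)"
      by (simp add: nn_integral_multc)
    also have "\<dots> = emeasure std_normal_distribution A * (\<integral>\<^sup>+ v. indicator C v \<partial>chi_square (card E))"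
    proof -
      have "(\<integral>\<^sup>+ v. indicator C v \<partial>chi_square (card E)) = (\<integral>\<^sup>+ z. indicator C (\<Sum>b\<in>E. (z b)\<^sup>2) \<partial>?P E)"
        unfolding chi_square_eq_distr_sum_squares[OF fin]
      proof (rule nn_integral_distr)
        show "(\<lambda>z. \<Sum>b\<in>E. (z b)\<^sup>2) \<in> borel_measurable (?P E)" by measurable
      qed simp
      moreover have "(\<integral>\<^sup>+ z. emeasure std_normal_distribution A * indicator C (\<Sum>b\<in>E. (z b)\<^sup>2) \<partial>?P E)
          = emeasure std_normal_distribution A * (\<integral>\<^sup>+ z. indicator C (\<Sum>b\<in>E. (z b)\<^sup>2) \<partial>?P E)"
        by (rule nn_integral_cmult) measurable
      ultimately show ?thesis by (simp only:)
    qed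
    finally show "emeasure std_normal_distribution A * emeasure (chi_square (card E)) C
        = emeasure (distr (?P (insert w E)) (borel \<Otimes>\<^sub>M borel) ?h) (A \<times> C)"
      by simp
  qed unfold_locales
  finally show ?thesis .
qed

section \<open>Least squares in a linear model with spherical normal errors\<close>

lemma matrix_inv_unique:
  fixes A B :: "real ^ 'n ^ 'n"
  assumes "A ** B = mat 1"
  shows "matrix_inv A = B"
proof -
  have BA: "B ** A = mat 1" using assms by (simp add: matrix_left_right_inverse)
  have "A ** matrix_inv A = mat 1 \<and> matrix_inv A ** A = mat 1"
    unfolding matrix_inv_def by (rule someI[of _ B]) (simp add: assms BA)
  then have "matrix_inv A ** (A ** B) = B" by (simp add: matrix_mul_assoc)
  then show ?thesis by (simp add: assms)
qed

lemma matrix_vector_inner_right: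
  fixes A :: "real ^ 'k ^ 'n"
  shows "x \<bullet> (A *v y) = (transpose A *v x) \<bullet> y"
  by (simp add: dot_lmul_matrix[symmetric])

text \<open>The quadratic form of the Gram matrix at \<open>x\<close> is the squared length of \<open>X *v x\<close>, so its kernel is
that of \<open>X\<close>.\<close>

lemma invertible_gram_matrix:
  fixes X :: "real ^ 'k ^ 'n"
  assumes "rank X = CARD('k)"
  shows "invertible (transpose X ** X)"
proof -
  have inj: "inj ((*v) X)" using assms full_rank_injective by blast
  have "x = 0" if "(transpose X ** X) *v x = 0" for x
  proof -
    have "(X *v x) \<bullet> (X *v x) = (transpose X *v (X *v x)) \<bullet> x"
      by (rule matrix_vector_inner_right)
    also have "\<dots> = 0" using that by (simp add: matrix_vector_mul_assoc)
    finally have "X *v x = X *v 0" by simp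
    then show ?thesis using inj by (simp only: inj_eq)
  qed
  then show ?thesis
    using invertible_left_inverse matrix_left_invertible_ker by blast
qed

lemma mat_eq_scaleR: "(mat c :: real ^ 'n ^ 'n) = c *\<^sub>R mat 1"
  by (simp add: mat_def vec_eq_iff)

lemma matrix_inv_mat:
  assumes "c \<noteq> 0"
  shows "matrix_inv (mat c :: real ^ 'n ^ 'n) = mat (inverse c)"
  unfolding mat_eq_scaleR[of c] mat_eq_scaleR[of "inverse c"]
  by (rule matrix_inv_unique) (use assms in \<open>simp add: matrix_scalar_ac scalar_matrix_assoc[symmetric]\<close>)

lemma multivariate_normal_density_spherical:
  fixes x :: "real ^ 'n"
  assumes "\<sigma> > 0"
  shows "multivariate_normal_density 0 (mat (\<sigma>\<^sup>2)) x
    = exp (- (norm (x /\<^sub>R \<sigma>))\<^sup>2 / 2) / (sqrt ((2 * pi) ^ CARD('n)) * \<sigma> ^ CARD('n))"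
proof -
  have "mat c *v x = c *\<^sub>R x" for c
    by (simp add: mat_eq_scaleR[of c] scaleR_matrix_vector_assoc[symmetric])
  moreover have "det (mat (\<sigma>\<^sup>2) :: real ^ 'n ^ 'n) = (\<sigma> ^ CARD('n))\<^sup>2"
    by (subst det_diagonal) (simp_all add: mat_def power_mult[symmetric] mult.commute)
  moreover have "x \<bullet> (inverse (\<sigma>\<^sup>2) *\<^sub>R x) = (norm (x /\<^sub>R \<sigma>))\<^sup>2"
    by (simp add: power_mult_distrib power_inverse flip: power2_norm_eq_inner)
  ultimately show ?thesis using assms
    by (simp add: multivariate_normal_density_def matrix_inv_mat real_sqrt_mult)
qed

text \<open>The substitution \<open>x = \<sigma> y\<close> in the density; the Jacobian cancels the root of the determinant.\<close>

lemma distr_scaled_spherical_normal: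
  fixes u :: "'a \<Rightarrow> real ^ 'n"
  assumes \<sigma>: "\<sigma> > 0"
    and u: "distributed M lborel u (\<lambda>x. ennreal (multivariate_normal_density 0 (mat (\<sigma>\<^sup>2)) x))"
  shows "distr M borel (\<lambda>\<omega>. u \<omega> /\<^sub>R \<sigma>) = std_gaussian"
proof (rule measure_eqI)
  have u_meas[measurable]: "u \<in> borel_measurable M"
    using distributed_measurable[OF u] by simp
  fix A assume "A \<in> sets (distr M borel (\<lambda>\<omega>. u \<omega> /\<^sub>R \<sigma>))"
  then have A[measurable]: "A \<in> sets borel" by simp
  let ?f = "\<lambda>x. exp (- (norm (x /\<^sub>R \<sigma>))\<^sup>2 / 2) / (sqrt ((2 * pi) ^ CARD('n)) * \<sigma> ^ CARD('n)) :: real"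
  have "emeasure (distr M borel (\<lambda>\<omega>. u \<omega> /\<^sub>R \<sigma>)) A = (\<integral>\<^sup>+ \<omega>. indicator A (u \<omega> /\<^sub>R \<sigma>) \<partial>M)"
    by (subst nn_integral_indicator[symmetric], simp, subst nn_integral_distr) simp_all
  also have "\<dots> = (\<integral>\<^sup>+ x. ennreal (?f x) * indicator A (x /\<^sub>R \<sigma>) \<partial>lborel)"
    by (subst distributed_nn_integral[OF u, symmetric])
      (simp_all add: multivariate_normal_density_spherical[OF \<sigma>])
  also have "\<dots> = (\<integral>\<^sup>+ x. ennreal (\<sigma> ^ CARD('n)) *
      (ennreal (?f (\<sigma> *\<^sub>R x)) * indicator A ((\<sigma> *\<^sub>R x) /\<^sub>R \<sigma>)) \<partial>lborel)"
  proof -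
    have "lborel = density (distr lborel borel (\<lambda>x. \<sigma> *\<^sub>R x :: real ^ 'n)) (\<lambda>_. ennreal (\<sigma> ^ CARD('n)))"
      using lborel_affine[of \<sigma> "0 :: real ^ 'n"] \<sigma> by simp
    then have "(\<integral>\<^sup>+ x. ennreal (?f x) * indicator A (x /\<^sub>R \<sigma>) \<partial>lborel)
        = (\<integral>\<^sup>+ x. ennreal (?f x) * indicator A (x /\<^sub>R \<sigma>)
            \<partial>density (distr lborel borel (\<lambda>x. \<sigma> *\<^sub>R x :: real ^ 'n)) (\<lambda>_. ennreal (\<sigma> ^ CARD('n))))"
      by (rule arg_cong)
    also have "\<dots> = (\<integral>\<^sup>+ x. ennreal (\<sigma> ^ CARD('n)) * (ennreal (?f x) * indicator A (x /\<^sub>R \<sigma>))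
        \<partial>distr lborel borel (\<lambda>x. \<sigma> *\<^sub>R x :: real ^ 'n))"
      by (rule nn_integral_density) measurable
    also have "\<dots> = (\<integral>\<^sup>+ x. ennreal (\<sigma> ^ CARD('n)) *
        (ennreal (?f (\<sigma> *\<^sub>R x)) * indicator A ((\<sigma> *\<^sub>R x) /\<^sub>R \<sigma>)) \<partial>lborel)"
      by (rule nn_integral_distr) measurable
    finally show ?thesis .
  qed
  also have "\<dots> = (\<integral>\<^sup>+ x. ennreal (exp (- (norm x)\<^sup>2 / 2) / sqrt ((2 * pi) ^ CARD('n))) * indicator A x \<partial>lborel)"
  proof (rule nn_integral_cong)
    fix x :: "real ^ 'n"
    let ?e = "exp (- (norm x)\<^sup>2 / 2)" and ?q = "sqrt ((2 * pi) ^ CARD('n))"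
    have "(\<sigma> *\<^sub>R x) /\<^sub>R \<sigma> = x" using \<sigma> by simp
    moreover have "ennreal (\<sigma> ^ CARD('n)) * ennreal (?e / (?q * \<sigma> ^ CARD('n))) = ennreal (?e / ?q)"
    proof -
      have "\<sigma> ^ CARD('n) * (?e / (?q * \<sigma> ^ CARD('n))) = ?e / ?q" using \<sigma> by simp
      moreover have "0 \<le> \<sigma> ^ CARD('n)" using \<sigma> by simp
      ultimately show ?thesis by (metis ennreal_mult')
    qed
    ultimately show "ennreal (\<sigma> ^ CARD('n)) * (ennreal (?f (\<sigma> *\<^sub>R x)) * indicator A ((\<sigma> *\<^sub>R x) /\<^sub>R \<sigma>))
        = ennreal (?e / ?q) * indicator A x"
      by (simp only: mult.assoc[symmetric])
  qed
  also have "\<dots> = emeasure std_gaussian A"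
    by (simp add: std_gaussian_eq_density_norm emeasure_density)
  finally show "emeasure (distr M borel (\<lambda>\<omega>. u \<omega> /\<^sub>R \<sigma>)) A = emeasure std_gaussian A" .
qed simp

text \<open>With \<open>G\<close> the inverse Gram matrix, \<open>v\<close> is the image under \<open>X\<close> of the \<open>i\<close>-th column of \<open>G\<close>: by
symmetry of \<open>G\<close> the error of the \<open>i\<close>-th coefficient is the inner product with this vector, and its
squared length is the \<open>i\<close>-th diagonal entry of \<open>G\<close>. The residual is the projection of \<open>u\<close> to the
orthogonal complement of the column space, for which \<open>E\<close> is an orthonormal basis.\<close>

lemma least_squares_decomposition:
  fixes X :: "real ^ 'k ^ 'n" and i :: 'k
  assumes rank: "rank X = CARD('k)" and card: "CARD('k) < CARD('n)"
  obtains v :: "real ^ 'n" and E :: "(real ^ 'n) set" where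
    "v \<noteq> 0" "xi X i = sqrt (real CARD('n)) * norm v"
    "\<And>\<theta> u. ls_estimator X (X *v \<theta> + u) $ i = \<theta> $ i + u \<bullet> v"
    "pairwise orthogonal E" "\<And>b. b \<in> E \<Longrightarrow> norm b = 1" "card E = CARD('n) - CARD('k)"
    "\<And>b. b \<in> E \<Longrightarrow> orthogonal b v"
    "\<And>\<theta> u. sigma_hat X (X *v \<theta> + u) = sqrt ((\<Sum>b\<in>E. (u \<bullet> b)\<^sup>2) / real (CARD('n) - CARD('k)))"
proof -
  let ?A = "transpose X ** X"
  define G where "G = matrix_inv ?A"
  obtain G' where "?A ** G' = mat 1"
    using invertible_gram_matrix[OF rank] unfolding invertible_def by blast
  then have AG: "?A ** G = mat 1" by (simp add: G_def matrix_inv_unique)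
  then have GA: "G ** ?A = mat 1" by (simp add: matrix_left_right_inverse)
  have "?A ** transpose G = transpose (G ** ?A)"
    by (simp add: matrix_transpose_mul)
  also have "\<dots> = mat 1" by (simp add: GA)
  finally have GT: "transpose G = G"
    unfolding G_def using matrix_inv_unique by metis
  define g where "g = G *v axis i 1"
  define v where "v = X *v g"
  have Ag: "?A *v g = axis i 1"
    by (simp add: g_def matrix_vector_mul_assoc AG)
  have g0: "g \<noteq> 0"
  proof
    assume "g = 0"
    with Ag have "axis i (1::real) = 0" by simp
    then show False by simp
  qed
  have inj: "inj ((*v) X)" using rank full_rank_injective by blast
  have v0: "v \<noteq> 0"
    using g0 injD[OF inj, of g 0] by (auto simp: v_def)
  have "v \<bullet> v = g \<bullet> (?A *v g)"
    by (simp add: v_def matrix_vector_inner_right matrix_vector_mul_assoc inner_commute)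
  also have "\<dots> = G $ i $ i"
    unfolding Ag by (simp add: g_def inner_axis matrix_vector_mult_basis column_def)
  finally have vv: "v \<bullet> v = G $ i $ i" .
  have "matrix_inv ((1 / real CARD('n)) *\<^sub>R ?A) = real CARD('n) *\<^sub>R G"
    by (rule matrix_inv_unique) (simp add: AG matrix_scalar_ac scalar_matrix_assoc[symmetric])
  then have xi: "xi X i = sqrt (real CARD('n)) * norm v"
    by (simp add: xi_def real_sqrt_mult norm_eq_sqrt_inner vv)
  have ls: "ls_estimator X (X *v \<theta> + u) = \<theta> + G *v (transpose X *v u)" for \<theta> u
    by (simp add: ls_estimator_def G_def[symmetric] matrix_vector_right_distrib
        matrix_vector_mul_assoc matrix_mul_assoc GA[unfolded matrix_mul_assoc])
  have ls_i: "ls_estimator X (X *v \<theta> + u) $ i = \<theta> $ i + u \<bullet> v" for \<theta> u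
  proof -
    have "(G *v (transpose X *v u)) $ i = axis i 1 \<bullet> (G *v (transpose X *v u))"
      by (simp add: inner_axis')
    also have "\<dots> = (G *v axis i 1) \<bullet> (transpose X *v u)"
      by (simp only: matrix_vector_inner_right GT)
    also have "\<dots> = u \<bullet> v"
      by (simp add: matrix_vector_inner_right v_def g_def inner_commute)
    finally show ?thesis by (simp add: ls)
  qed
  define R where "R = range (\<lambda>x. X *v x)"
  have subR: "subspace R"
    unfolding R_def by (intro linear_subspace_image) (auto simp: matrix_vector_mul_linear)
  define C where "C = {y \<in> UNIV. \<forall>x\<in>R. orthogonal x y}"
  have "subspace C"
    by (auto simp: C_def subspace_def orthogonal_clauses)
  then obtain E where E: "E \<subseteq> C" "pairwise orthogonal E" "\<And>x. x \<in> E \<Longrightarrow> norm x = 1"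
    "independent E" "card E = dim C" "span E = C"
    using orthonormal_basis_subspace by metis
  have "dim C + dim R = CARD('n)"
    using dim_subspace_orthogonal_to_vectors[OF subR subspace_UNIV] by (simp add: C_def)
  moreover have "dim R = CARD('k)"
    using rank by (simp add: R_def rank_dim_range)
  ultimately have cardE: "card E = CARD('n) - CARD('k)" using E(5) by simp
  have finE: "finite E" using E(4) by (rule independent_imp_finite)
  have orthE: "orthogonal b (X *v x)" if "b \<in> E" for b x
    using E(1) that by (auto simp: C_def R_def orthogonal_commute)
  have sigma: "sigma_hat X (X *v \<theta> + u) = sqrt ((\<Sum>b\<in>E. (u \<bullet> b)\<^sup>2) / real (CARD('n) - CARD('k)))" for \<theta> u
  proof -
    define r where "r = X *v \<theta> + u - X *v ls_estimator X (X *v \<theta> + u)"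
    have r: "r = u - X *v (G *v (transpose X *v u))"
      by (simp add: r_def ls matrix_vector_right_distrib)
    have "transpose X *v r = transpose X *v u - (?A ** G) *v (transpose X *v u)"
      by (simp add: r matrix_vector_mult_diff_distrib matrix_vector_mul_assoc matrix_mul_assoc)
    then have "transpose X *v r = 0" by (simp add: AG)
    then have "r \<in> C"
      by (auto simp: C_def R_def orthogonal_def matrix_vector_inner_right inner_commute[of _ r])
    then have exp: "(\<Sum>b\<in>E. (r \<bullet> b) *\<^sub>R b) = r"
      using E finE by (intro orthonormal_basis_expand) auto
    have "r \<bullet> r = r \<bullet> (\<Sum>b\<in>E. (r \<bullet> b) *\<^sub>R b)" by (simp add: exp)
    also have "\<dots> = (\<Sum>b\<in>E. (r \<bullet> b)\<^sup>2)" by (simp add: inner_sum_right power2_eq_square)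
    also have "\<dots> = (\<Sum>b\<in>E. (u \<bullet> b)\<^sup>2)"
    proof (intro sum.cong refl)
      fix b assume "b \<in> E"
      then show "(r \<bullet> b)\<^sup>2 = (u \<bullet> b)\<^sup>2"
        using orthE[of b "G *v (transpose X *v u)"] unfolding r
        by (simp add: inner_diff_left orthogonal_def inner_commute[of b])
    qed
    finally show ?thesis using card by (simp add: sigma_hat_def r_def[symmetric] of_nat_diff)
  qed
  show thesis
  proof (rule that[of v E])
    show "orthogonal b v" if "b \<in> E" for b using orthE[OF that] by (simp add: v_def)
  qed (use v0 xi ls_i E cardE sigma in auto)
qed

section \<open>Soft thresholding of a normal variable\<close>

definition soft_threshold :: "real \<Rightarrow> real \<Rightarrow> real" where
  "soft_threshold c b = sgn b * max (\<bar>b\<bar> - c) 0"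

lemma soft_threshold_cases:
  assumes "c \<ge> 0"
  shows "soft_threshold c b = (if b > c then b - c else if b \<le> - c then b + c else 0)"
  using assms by (auto simp: soft_threshold_def sgn_if max_def)

text \<open>Soft thresholding is monotone in \<open>b\<close>, so its sublevel sets are half-lines. For \<open>t \<ge> 0\<close> they contain
the whole interval that is sent to zero, which is why the threshold enters with opposite signs.\<close>

lemma soft_threshold_le_iff:
  assumes "c \<ge> 0"
  shows "soft_threshold c b \<le> t \<longleftrightarrow> b \<le> (if t \<ge> 0 then t + c else t - c)"
  using assms by (auto simp: soft_threshold_cases)

lemma soft_threshold_scale:
  assumes "k > 0"
  shows "soft_threshold (k * c) (k * b) = k * soft_threshold c b"
proof -
  have "max (\<bar>k * b\<bar> - k * c) 0 = k * max (\<bar>b\<bar> - c) 0"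
    using assms by (simp add: abs_mult max_def right_diff_distrib[symmetric] zero_le_mult_iff mult_le_0_iff)
  then show ?thesis using assms by (simp add: soft_threshold_def sgn_mult)
qed

lemma borel_measurable_soft_threshold [measurable (raw)]:
  assumes [measurable]: "f \<in> borel_measurable M" "g \<in> borel_measurable M"
  shows "(\<lambda>x. soft_threshold (f x) (g x)) \<in> borel_measurable M"
  unfolding soft_threshold_def by measurable

interpretation std_normal: real_distribution std_normal_distribution
  using prob_space_std_normal by (simp add: real_distribution_def real_distribution_axioms_def)

lemma measure_std_normal_atMost: "measure std_normal_distribution {..x} = std_normal_cdf x"
  by (simp add: std_normal_cdf_def cdf_def)

lemma borel_measurable_std_normal_cdf [measurable]: "std_normal_cdf \<in> borel_measurable borel"
  unfolding std_normal_cdf_def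
  by (intro borel_measurable_mono monoI std_normal.cdf_nondecreasing)

lemma std_normal_cdf_bounds: "0 \<le> std_normal_cdf x" "std_normal_cdf x \<le> 1"
  by (simp_all add: std_normal_cdf_def std_normal.cdf_nonneg std_normal.cdf_bounded_prob)

lemma emeasure_std_normal_greaterThanAtMost:
  assumes "a \<le> b"
  shows "emeasure std_normal_distribution {a<..b} = ennreal (std_normal_cdf b - std_normal_cdf a)"
proof (cases "a = b")
  case False
  then have "a < b" using assms by simp
  then show ?thesis using std_normal.cdf_diff_eq[of a b]
    by (simp add: std_normal_cdf_def std_normal.emeasure_eq_measure)
qed simp

lemma measure_std_normal_soft_threshold_le:
  assumes "d > 0" "c \<ge> 0"
  shows "measure std_normal_distribution {z. d * (soft_threshold c (\<tau> + z) - \<tau>) \<le> x}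
    = std_normal_cdf (x / d + (if x / d + \<tau> \<ge> 0 then c else - c))"
proof -
  have "d * (soft_threshold c (\<tau> + z) - \<tau>) \<le> x \<longleftrightarrow> soft_threshold c (\<tau> + z) \<le> x / d + \<tau>" for z
    using assms(1) by (auto simp: field_simps)
  then have "{z. d * (soft_threshold c (\<tau> + z) - \<tau>) \<le> x} = {..x / d + (if x / d + \<tau> \<ge> 0 then c else - c)}"
    by (auto simp: soft_threshold_le_iff[OF assms(2)])
  then show ?thesis by (simp add: measure_std_normal_atMost)
qed

text \<open>The change of variables \<open>z = x / d + c\<close>. The predicate \<open>P\<close> selects the half-line on which soft
thresholding acts as this affine map.\<close>

lemma nn_integral_std_normal_tail:
  assumes "d > 0" and [measurable]: "A \<in> sets borel" "Measurable.pred borel P"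
  shows "(\<integral>\<^sup>+ z. indicator A (d * (z - c)) * of_bool (P (d * (z - c))) \<partial>std_normal_distribution)
    = (\<integral>\<^sup>+ x. ennreal (inverse d * (std_normal_density (x / d + c) * of_bool (P x))) * indicator A x \<partial>lborel)"
proof -
  have "(\<integral>\<^sup>+ z. indicator A (d * (z - c)) * of_bool (P (d * (z - c))) \<partial>std_normal_distribution)
      = (\<integral>\<^sup>+ z. ennreal (std_normal_density z) * (indicator A (d * (z - c)) * of_bool (P (d * (z - c)))) \<partial>lborel)"
    by (simp add: nn_integral_density)
  also have "\<dots> = ennreal \<bar>1 / d\<bar> * (\<integral>\<^sup>+ x. ennreal (std_normal_density (c + 1 / d * x)) *
      (indicator A (d * (c + 1 / d * x - c)) * of_bool (P (d * (c + 1 / d * x - c)))) \<partial>lborel)"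
    using assms(1) by (intro nn_integral_real_affine) simp_all
  also have "\<dots> = (\<integral>\<^sup>+ x. ennreal (inverse d * (std_normal_density (x / d + c) * of_bool (P x))) * indicator A x \<partial>lborel)"
    using assms(1)
    by (subst nn_integral_cmult[symmetric])
      (auto intro!: nn_integral_cong simp: ennreal_mult' add.commute divide_inverse mult_ac split: split_indicator)
  finally show ?thesis .
qed

text \<open>The variable \<open>\<tau> + z\<close> lies above \<open>c\<close>, below \<open>- c\<close>, or between the two. The middle case sends \<open>z\<close> to
the atom \<open>- d * \<tau>\<close>; in the outer cases the map is affine.\<close>

lemma emeasure_std_normal_soft_threshold:
  assumes d: "d > 0" and c: "c \<ge> 0" and A[measurable]: "A \<in> sets borel"
  shows "emeasure std_normal_distribution {z. d * (soft_threshold c (\<tau> + z) - \<tau>) \<in> A}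
    = ennreal (std_normal_cdf (- \<tau> + c) - std_normal_cdf (- \<tau> - c)) * indicator A (- d * \<tau>)
    + (\<integral>\<^sup>+ x. ennreal (inverse d * (std_normal_density (x / d + c) * of_bool (x / d + \<tau> > 0)
        + std_normal_density (x / d - c) * of_bool (x / d + \<tau> < 0))) * indicator A x \<partial>lborel)"
proof -
  let ?N = std_normal_distribution
  let ?s = "\<lambda>z. d * (soft_threshold c (\<tau> + z) - \<tau>)"
  have "emeasure ?N {z. ?s z \<in> A} = (\<integral>\<^sup>+ z. indicator A (?s z) \<partial>?N)"
  proof -
    have "{z. ?s z \<in> A} \<in> sets ?N" by measurable
    moreover have "indicator A (?s z) = (indicator {z. ?s z \<in> A} z :: ennreal)" for z
      by (simp add: indicator_def)
    ultimately show ?thesis by (simp only: nn_integral_indicator)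
  qed
  \<comment> \<open>The middle interval is half-open to match differences of the distribution function; its left endpoint belongs to the lower affine piece, which takes the same value there.\<close>
  also have "\<dots> = (\<integral>\<^sup>+ z. indicator A (- d * \<tau>) * indicator {- \<tau> - c <.. - \<tau> + c} z
      + (indicator A (d * (z - c)) * of_bool (d * (z - c) / d + \<tau> > 0)
      + indicator A (d * (z - (- c))) * of_bool (d * (z - (- c)) / d + \<tau> \<le> 0)) \<partial>?N)"
  proof (rule nn_integral_cong)
    fix z
    have eq: "d * (z - c) / d + \<tau> = z - c + \<tau>" "d * (z - (- c)) / d + \<tau> = z + c + \<tau>"
      using d by simp_all
    consider "\<tau> + z > c" | "\<tau> + z \<le> - c" | "- c < \<tau> + z" "\<tau> + z \<le> c" by linarith
    then show "indicator A (?s z) = (indicator A (- d * \<tau>) * indicator {- \<tau> - c <.. - \<tau> + c} z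
      + (indicator A (d * (z - c)) * of_bool (d * (z - c) / d + \<tau> > 0)
      + indicator A (d * (z - (- c))) * of_bool (d * (z - (- c)) / d + \<tau> \<le> 0)) :: ennreal)"
      unfolding eq by cases (use c in \<open>auto simp: soft_threshold_cases\<close>)
  qed
  also have "\<dots> = indicator A (- d * \<tau>) * emeasure ?N {- \<tau> - c <.. - \<tau> + c}
      + ((\<integral>\<^sup>+ z. indicator A (d * (z - c)) * of_bool (d * (z - c) / d + \<tau> > 0) \<partial>?N)
      + (\<integral>\<^sup>+ z. indicator A (d * (z - (- c))) * of_bool (d * (z - (- c)) / d + \<tau> \<le> 0) \<partial>?N))"
    by (subst nn_integral_add, simp, simp, subst nn_integral_add, simp, simp, subst nn_integral_cmult) simp_all
  also have "\<dots> = indicator A (- d * \<tau>) * emeasure ?N {- \<tau> - c <.. - \<tau> + c}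
      + (\<integral>\<^sup>+ x. ennreal (inverse d * (std_normal_density (x / d + c) * of_bool (x / d + \<tau> > 0))) * indicator A x
         + ennreal (inverse d * (std_normal_density (x / d + - c) * of_bool (x / d + \<tau> \<le> 0))) * indicator A x \<partial>lborel)"
    by (subst nn_integral_add, simp, simp,
        subst nn_integral_std_normal_tail[OF d A, where P = "\<lambda>x. x / d + \<tau> > 0"], simp,
        subst nn_integral_std_normal_tail[OF d A, where P = "\<lambda>x. x / d + \<tau> \<le> 0"]) simp_all
  also have "(\<integral>\<^sup>+ x. ennreal (inverse d * (std_normal_density (x / d + c) * of_bool (x / d + \<tau> > 0))) * indicator A x
         + ennreal (inverse d * (std_normal_density (x / d + - c) * of_bool (x / d + \<tau> \<le> 0))) * indicator A x \<partial>lborel)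
    = (\<integral>\<^sup>+ x. ennreal (inverse d * (std_normal_density (x / d + c) * of_bool (x / d + \<tau> > 0)
        + std_normal_density (x / d - c) * of_bool (x / d + \<tau> < 0))) * indicator A x \<partial>lborel)"
  proof (rule nn_integral_cong_AE)
    \<comment> \<open>Strict and weak inequality differ at a single point.\<close>
    have "AE x in lborel. x \<noteq> - d * \<tau>" by (rule AE_lborel_singleton)
    then show "AE x in lborel. ennreal (inverse d * (std_normal_density (x / d + c) * of_bool (x / d + \<tau> > 0))) * indicator A x
         + ennreal (inverse d * (std_normal_density (x / d + - c) * of_bool (x / d + \<tau> \<le> 0))) * indicator A x
      = ennreal (inverse d * (std_normal_density (x / d + c) * of_bool (x / d + \<tau> > 0)
        + std_normal_density (x / d - c) * of_bool (x / d + \<tau> < 0))) * indicator A x"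
    proof eventually_elim
      case (elim x)
      then have "x / d + \<tau> \<noteq> 0" using d by (auto simp: field_simps)
      then show ?case by (cases "x / d + \<tau> > 0") auto
    qed
  qed
  finally show ?thesis using c by (simp add: emeasure_std_normal_greaterThanAtMost mult.commute)
qed

section \<open>Mixing over the law of the estimated scale\<close>

definition root_chi_square :: "nat \<Rightarrow> real measure" where
  "root_chi_square m = distr (chi_square m) borel (\<lambda>v. sqrt v / sqrt (real m))"

lemma sets_root_chi_square [simp, measurable_cong]: "sets (root_chi_square m) = sets borel"
  and space_root_chi_square [simp]: "space (root_chi_square m) = UNIV"
  by (simp_all add: root_chi_square_def)

lemma prob_space_root_chi_square: "prob_space (root_chi_square m)"
  unfolding root_chi_square_def
  by (rule prob_space.prob_space_distr[OF prob_space_chi_square]) simp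

lemma borel_measurable_root_chi_square_density [measurable]:
  "root_chi_square_density m \<in> borel_measurable borel"
  unfolding root_chi_square_density_def by measurable

lemma root_chi_square_density_nonneg: "root_chi_square_density m s \<ge> 0"
  by (simp add: root_chi_square_density_def)

lemma root_chi_square_eq_density:
  assumes "m > 0"
  shows "root_chi_square m = density lborel (\<lambda>s. ennreal (root_chi_square_density m s))"
proof -
  have "root_chi_square m = distr (chi_square m) lborel (\<lambda>v. sqrt v / sqrt (real m))"
    unfolding root_chi_square_def by (rule distr_cong) simp_all
  then show ?thesis
    using distributed_distr_eq_density[OF distributed_root_chi_square[OF assms]] by simp
qed

lemma AE_root_chi_square_pos:
  assumes "m > 0"
  shows "AE s in root_chi_square m. s > 0"
proof -
  have "AE v in chi_square m. v \<ge> 0"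
    unfolding chi_square_def by (subst AE_distr_iff) (auto intro!: AE_I2 sum_nonneg)
  then have "AE s in root_chi_square m. s \<ge> 0"
    unfolding root_chi_square_def by (subst AE_distr_iff) auto
  moreover have "AE s in root_chi_square m. s \<noteq> 0"
    unfolding root_chi_square_eq_density[OF assms]
    using AE_lborel_singleton[of "0::real"] by (subst AE_density) auto
  ultimately show ?thesis by eventually_elim simp
qed

text \<open>The law lives on the positive half-line, so \<open>p\<close> needs bounds only there; the point 0, which
\<open>{0..}\<close> adds, carries no mass.\<close>

lemma nn_integral_root_chi_square:
  assumes m: "m > 0" and [measurable]: "p \<in> borel_measurable borel"
    and bounds: "\<And>s. s > 0 \<Longrightarrow> 0 \<le> p s" "\<And>s. s > 0 \<Longrightarrow> p s \<le> C"
  shows "(\<integral>\<^sup>+ s. ennreal (p s) \<partial>root_chi_square m)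
    = ennreal (LBINT s:{0..}. p s * root_chi_square_density m s)"
proof -
  interpret R: prob_space "root_chi_square m" by (rule prob_space_root_chi_square)
  let ?q = "\<lambda>s. indicator {0..} s * p s"
  have AE: "AE s in root_chi_square m. 0 \<le> ?q s" "AE s in root_chi_square m. norm (?q s) \<le> C"
    using AE_root_chi_square_pos[OF m] bounds by (auto elim!: eventually_mono)
  have "(\<integral>\<^sup>+ s. ennreal (p s) \<partial>root_chi_square m) = (\<integral>\<^sup>+ s. ennreal (?q s) \<partial>root_chi_square m)"
    using AE_root_chi_square_pos[OF m] by (intro nn_integral_cong_AE) (auto elim!: eventually_mono)
  also have "\<dots> = ennreal (\<integral> s. ?q s \<partial>root_chi_square m)"
    by (intro nn_integral_eq_integral R.integrable_const_bound[OF AE(2)] AE(1)) measurable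
  also have "(\<integral> s. ?q s \<partial>root_chi_square m) = (\<integral> s. root_chi_square_density m s *\<^sub>R ?q s \<partial>lborel)"
    unfolding root_chi_square_eq_density[OF m]
    by (intro integral_density) (auto simp: root_chi_square_density_nonneg)
  also have "\<dots> = (LBINT s:{0..}. p s * root_chi_square_density m s)"
    unfolding set_lebesgue_integral_def by (intro Bochner_Integration.integral_cong) auto
  finally show ?thesis .
qed

text \<open>Conditioning on the chi-square variable: by independence \<open>S\<close> can be frozen at \<open>s\<close> while the normal
variable is integrated out.\<close>

lemma emeasure_distr_normal_chi_square:
  assumes g: "(\<lambda>(z, s). g z s) \<in> borel_measurable (borel \<Otimes>\<^sub>M borel)" and A[measurable]: "A \<in> sets borel"
  shows "emeasure (distr (std_normal_distribution \<Otimes>\<^sub>M chi_square m) borel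
      (\<lambda>(z, v). g z (sqrt v / sqrt (real m)))) A
    = (\<integral>\<^sup>+ s. emeasure std_normal_distribution {z. g z s \<in> A} \<partial>root_chi_square m)"
proof -
  interpret C: prob_space "chi_square m" by (rule prob_space_chi_square)
  interpret P: pair_prob_space std_normal_distribution "chi_square m" ..
  have [measurable]: "(\<lambda>x. g (f x) (h x)) \<in> borel_measurable N"
    if [measurable]: "f \<in> borel_measurable N" "h \<in> borel_measurable N" for f h and N :: "'b measure"
    using measurable_compose[OF measurable_Pair[OF that] g] by simp
  let ?G = "\<lambda>(z, v). g z (sqrt v / sqrt (real m))"
  have [measurable]: "?G \<in> borel_measurable (std_normal_distribution \<Otimes>\<^sub>M chi_square m)"
    using g by measurable
  have "emeasure (distr (std_normal_distribution \<Otimes>\<^sub>M chi_square m) borel ?G) A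
      = (\<integral>\<^sup>+ y. indicator A y \<partial>distr (std_normal_distribution \<Otimes>\<^sub>M chi_square m) borel ?G)"
    by simp
  also have "\<dots> = (\<integral>\<^sup>+ x. indicator A (?G x) \<partial>(std_normal_distribution \<Otimes>\<^sub>M chi_square m))"
    by (rule nn_integral_distr) measurable
  also have "\<dots> = (\<integral>\<^sup>+ v. \<integral>\<^sup>+ z. indicator A (g z (sqrt v / sqrt (real m))) \<partial>std_normal_distribution \<partial>chi_square m)"
    by (subst P.nn_integral_snd[symmetric]) simp_all
  also have "\<dots> = (\<integral>\<^sup>+ s. \<integral>\<^sup>+ z. indicator A (g z s) \<partial>std_normal_distribution \<partial>root_chi_square m)"
    unfolding root_chi_square_def by (rule nn_integral_distr[symmetric]) measurable
  also have "\<dots> = (\<integral>\<^sup>+ s. emeasure std_normal_distribution {z. g z s \<in> A} \<partial>root_chi_square m)"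
  proof (rule nn_integral_cong)
    fix s
    have "{z. g z s \<in> A} \<in> sets std_normal_distribution" by measurable
    moreover have "indicator A (g z s) = (indicator {z. g z s \<in> A} z :: ennreal)" for z
      by (simp add: indicator_def)
    ultimately show "(\<integral>\<^sup>+ z. indicator A (g z s) \<partial>std_normal_distribution)
        = emeasure std_normal_distribution {z. g z s \<in> A}"
      by (simp only: nn_integral_indicator)
  qed
  finally show ?thesis .
qed

lemma measure_distr_normal_chi_square:
  assumes m: "m > 0"
    and g: "(\<lambda>(z, s). g z s) \<in> borel_measurable (borel \<Otimes>\<^sub>M borel)" and A: "A \<in> sets borel"
    and p: "p \<in> borel_measurable borel"
    and cond: "\<And>s. s > 0 \<Longrightarrow> measure std_normal_distribution {z. g z s \<in> A} = p s"
  shows "measure (distr (std_normal_distribution \<Otimes>\<^sub>M chi_square m) borel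
      (\<lambda>(z, v). g z (sqrt v / sqrt (real m)))) A
    = (LBINT s:{0..}. p s * root_chi_square_density m s)" (is "measure ?D A = ?I")
proof -
  have p01: "0 \<le> p s" "p s \<le> 1" if "s > 0" for s
    using cond[OF that, symmetric] by simp_all
  have "emeasure ?D A = (\<integral>\<^sup>+ s. ennreal (p s) \<partial>root_chi_square m)"
    unfolding emeasure_distr_normal_chi_square[OF g A]
    using AE_root_chi_square_pos[OF m]
    by (intro nn_integral_cong_AE) (auto elim!: eventually_mono simp: std_normal.emeasure_eq_measure cond)
  also have "\<dots> = ennreal ?I"
    using p01 by (rule nn_integral_root_chi_square[OF m p])
  finally have *: "emeasure ?D A = ennreal ?I" .
  have "AE s in lborel. 0 \<le> indicator {0..} s *\<^sub>R (p s * root_chi_square_density m s)"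
    using AE_lborel_singleton[of "0::real"]
    by eventually_elim (auto simp: indicator_def p01 root_chi_square_density_nonneg)
  then have "?I \<ge> 0"
    unfolding set_lebesgue_integral_def by (rule integral_nonneg_AE)
  with * show ?thesis by (simp add: measure_def)
qed

lemma noncentral_t_cdf_eq_integral:
  assumes m: "m > 0"
  shows "noncentral_t_cdf m c t
    = (LBINT s:{0..}. std_normal_cdf (t * s - c) * root_chi_square_density m s)"
proof -
  have "noncentral_t_cdf m c t = measure (distr (std_normal_distribution \<Otimes>\<^sub>M chi_square m) borel
      (\<lambda>(z, v). (z + c) / (sqrt v / sqrt (real m)))) {..t}"
    by (simp add: noncentral_t_cdf_def noncentral_t_def cdf_def real_sqrt_divide)
  also have "\<dots> = (LBINT s:{0..}. std_normal_cdf (t * s - c) * root_chi_square_density m s)"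
  proof (rule measure_distr_normal_chi_square[OF m])
    fix s :: real assume "s > 0"
    then have "{z. (z + c) / s \<in> {..t}} = {..t * s - c}" by (auto simp: field_simps)
    then show "measure std_normal_distribution {z. (z + c) / s \<in> {..t}} = std_normal_cdf (t * s - c)"
      by (simp add: measure_std_normal_atMost)
  qed measurable
  finally show ?thesis .
qed

lemma std_normal_density_le_1: "std_normal_density x \<le> 1"
proof -
  have "1 / sqrt (2 * pi) \<le> 1" using pi_ge_two by simp
  moreover have "exp (- x\<^sup>2 / 2) \<le> 1" by simp
  ultimately show ?thesis unfolding std_normal_density_def by (intro mult_le_one) auto
qed

text \<open>The law of the thresholded variable in standardized units: \<open>\<tau>\<close> is the true coefficient, \<open>a S\<close>
the random threshold, and \<open>d\<close> converts to the scale of the scaled estimation error.\<close>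

context
  fixes m :: nat and d a \<tau> :: real and \<mu> :: "real measure"
  assumes m: "m > 0" and d: "d > 0" and a: "a > 0"
  defines "\<mu> \<equiv> distr (std_normal_distribution \<Otimes>\<^sub>M chi_square m) borel
      (\<lambda>(z, v). d * (soft_threshold (a * (sqrt v / sqrt (real m))) (\<tau> + z) - \<tau>))"
begin

lemma cdf_soft_threshold_normal_chi_square:
  "cdf \<mu> x = (LBINT s:{0..}. std_normal_cdf (x / d + (if x / d + \<tau> \<ge> 0 then a * s else - (a * s)))
     * root_chi_square_density m s)"
  unfolding cdf_def \<mu>_def
proof (rule measure_distr_normal_chi_square[OF m])
  show "(\<lambda>(z, s). d * (soft_threshold (a * s) (\<tau> + z) - \<tau>)) \<in> borel_measurable (borel \<Otimes>\<^sub>M borel)"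
    by measurable
  show "measure std_normal_distribution {z. d * (soft_threshold (a * s) (\<tau> + z) - \<tau>) \<in> {..x}}
      = std_normal_cdf (x / d + (if x / d + \<tau> \<ge> 0 then a * s else - (a * s)))" if "s > 0" for s
    using measure_std_normal_soft_threshold_le[OF d, of "a * s" \<tau> x] a that by simp
qed measurable

lemma emeasure_soft_threshold_normal_chi_square:
  assumes A[measurable]: "A \<in> sets borel"
  shows "emeasure \<mu> A =
    ennreal (LBINT s:{0..}. (std_normal_cdf (- \<tau> + a * s) - std_normal_cdf (- \<tau> - a * s))
      * root_chi_square_density m s) * indicator A (- d * \<tau>)
    + (\<integral>\<^sup>+ x. ennreal (inverse d *
        ((LBINT s:{0..}. std_normal_density (x / d + a * s) * root_chi_square_density m s) * of_bool (x / d + \<tau> > 0)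
        + (LBINT s:{0..}. std_normal_density (x / d - a * s) * root_chi_square_density m s) * of_bool (x / d + \<tau> < 0)))
        * indicator A x \<partial>lborel)"
proof -
  let ?R = "root_chi_square m"
  interpret R: prob_space ?R by (rule prob_space_root_chi_square)
  interpret P: pair_sigma_finite ?R "lborel :: real measure" ..
  let ?f = "\<lambda>x s. inverse d * (std_normal_density (x / d + a * s) * of_bool (x / d + \<tau> > 0)
        + std_normal_density (x / d - a * s) * of_bool (x / d + \<tau> < 0))"
  let ?atom = "\<lambda>s. std_normal_cdf (- \<tau> + a * s) - std_normal_cdf (- \<tau> - a * s)"
  have "emeasure \<mu> A = (\<integral>\<^sup>+ s. emeasure std_normal_distribution
      {z. d * (soft_threshold (a * s) (\<tau> + z) - \<tau>) \<in> A} \<partial>?R)"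
    unfolding \<mu>_def by (rule emeasure_distr_normal_chi_square[OF _ A]) measurable
  also have "\<dots> = (\<integral>\<^sup>+ s. ennreal (?atom s) * indicator A (- d * \<tau>)
      + (\<integral>\<^sup>+ x. ennreal (?f x s) * indicator A x \<partial>lborel) \<partial>?R)"
  proof (rule nn_integral_cong_AE)
    show "AE s in ?R. emeasure std_normal_distribution {z. d * (soft_threshold (a * s) (\<tau> + z) - \<tau>) \<in> A}
      = ennreal (?atom s) * indicator A (- d * \<tau>) + (\<integral>\<^sup>+ x. ennreal (?f x s) * indicator A x \<partial>lborel)"
      using AE_root_chi_square_pos[OF m] 
    proof eventually_elim
      case (elim s)
      then have "a * s \<ge> 0" using a by simp
      from emeasure_std_normal_soft_threshold[OF d this A, of \<tau>] show ?case .
    qed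
  qed
  also have "\<dots> = (\<integral>\<^sup>+ s. ennreal (?atom s) * indicator A (- d * \<tau>) \<partial>?R)
      + (\<integral>\<^sup>+ s. (\<integral>\<^sup>+ x. ennreal (?f x s) * indicator A x \<partial>lborel) \<partial>?R)"
    by (rule nn_integral_add) measurable
  also have "(\<integral>\<^sup>+ s. ennreal (?atom s) * indicator A (- d * \<tau>) \<partial>?R)
      = ennreal (LBINT s:{0..}. ?atom s * root_chi_square_density m s) * indicator A (- d * \<tau>)"
  proof -
    have "0 \<le> ?atom s" "?atom s \<le> 1" if "s > 0" for s
    proof -
      show "0 \<le> ?atom s"
        using that a by (simp add: std_normal_cdf_def std_normal.cdf_nondecreasing)
      show "?atom s \<le> 1"
        using std_normal_cdf_bounds(2)[of "- \<tau> + a * s"] std_normal_cdf_bounds(1)[of "- \<tau> - a * s"] by linarith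
    qed
    then show ?thesis
      by (subst nn_integral_multc, simp, subst nn_integral_root_chi_square[OF m, where C = 1]) auto
  qed
  \<comment> \<open>Exchanging the integrals turns the mixture of conditional densities into one density.\<close>
  also have "(\<integral>\<^sup>+ s. (\<integral>\<^sup>+ x. ennreal (?f x s) * indicator A x \<partial>lborel) \<partial>?R)
      = (\<integral>\<^sup>+ x. (\<integral>\<^sup>+ s. ennreal (?f x s) * indicator A x \<partial>?R) \<partial>lborel)"
    by (rule P.Fubini'[symmetric]) measurable
  also have "\<dots> = (\<integral>\<^sup>+ x. ennreal (inverse d *
        ((LBINT s:{0..}. std_normal_density (x / d + a * s) * root_chi_square_density m s) * of_bool (x / d + \<tau> > 0)
        + (LBINT s:{0..}. std_normal_density (x / d - a * s) * root_chi_square_density m s) * of_bool (x / d + \<tau> < 0)))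
        * indicator A x \<partial>lborel)"
  proof (rule nn_integral_cong)
    fix x :: real
    have "(\<integral>\<^sup>+ s. ennreal (?f x s) \<partial>?R) = ennreal (LBINT s:{0..}. ?f x s * root_chi_square_density m s)"
    proof (rule nn_integral_root_chi_square[OF m, where C = "inverse d"])
      fix s
      show "0 \<le> ?f x s" using d by simp
      have "std_normal_density (x / d + a * s) * of_bool (x / d + \<tau> > 0)
        + std_normal_density (x / d - a * s) * of_bool (x / d + \<tau> < 0) \<le> 1"
        by (auto simp: std_normal_density_le_1)
      then show "?f x s \<le> inverse d" using d by (intro mult_left_le) auto
    qed measurable
    also have "(LBINT s:{0..}. ?f x s * root_chi_square_density m s)
      = inverse d * ((LBINT s:{0..}. std_normal_density (x / d + a * s) * root_chi_square_density m s) * of_bool (x / d + \<tau> > 0)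
        + (LBINT s:{0..}. std_normal_density (x / d - a * s) * root_chi_square_density m s) * of_bool (x / d + \<tau> < 0))"
      by (cases "x / d + \<tau> > 0"; cases "x / d + \<tau> < 0") (auto simp: mult.assoc)
    finally show "(\<integral>\<^sup>+ s. ennreal (?f x s) * indicator A x \<partial>?R) = ennreal (inverse d *
        ((LBINT s:{0..}. std_normal_density (x / d + a * s) * root_chi_square_density m s) * of_bool (x / d + \<tau> > 0)
        + (LBINT s:{0..}. std_normal_density (x / d - a * s) * root_chi_square_density m s) * of_bool (x / d + \<tau> < 0)))
        * indicator A x"
      by (subst nn_integral_multc) simp_all
  qed
  finally show ?thesis .
qed

end

section \<open>The finite-sample distribution of the soft-thresholding estimator\<close>

text \<open>With \<open>\<kappa> = \<sigma> * norm v\<close>, the least squares coordinate is \<open>\<kappa> * (\<tau> + Z)\<close> and the threshold is \<open>\<kappa>\<close> times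
\<open>r * \<eta> * S\<close>, so that \<open>\<kappa>\<close> factors out of the estimator. The joint law of \<open>Z\<close> and \<open>S\<close> that remains
is free of the parameters.\<close>

lemma distr_soft_threshold_error:
  fixes X :: "real ^ 'k ^ 'n" and \<theta> :: "real ^ 'k" and i :: 'k and u :: "'a \<Rightarrow> real ^ 'n"
  assumes card: "CARD('k) < CARD('n)" and rank: "rank X = CARD('k)"
    and \<sigma>: "\<sigma> > 0"
    and u: "distributed M lborel u (\<lambda>x. ennreal (multivariate_normal_density 0 (mat (\<sigma>\<^sup>2)) x))"
  defines "m \<equiv> CARD('n) - CARD('k)" and "\<xi> \<equiv> xi X i" and "r \<equiv> sqrt (real CARD('n))"
  shows "xi X i > 0"
    and "distr M borel (\<lambda>\<omega>. inverse \<sigma> * \<alpha> * (soft_threshold_estimator X \<eta> (X *v \<theta> + u \<omega>) i - \<theta> $ i))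
    = distr (std_normal_distribution \<Otimes>\<^sub>M chi_square m) borel
        (\<lambda>(z, v). \<alpha> * \<xi> / r * (soft_threshold (r * \<eta> * (sqrt v / sqrt (real m)))
          (r * \<theta> $ i / (\<sigma> * \<xi>) + z) - r * \<theta> $ i / (\<sigma> * \<xi>)))" (is "?L = distr ?P borel ?H")
proof -
  obtain v :: "real ^ 'n" and E where v: "v \<noteq> 0" and xi: "xi X i = r * norm v"
    and ls: "\<And>\<theta> u. ls_estimator X (X *v \<theta> + u) $ i = \<theta> $ i + u \<bullet> v"
    and E: "pairwise orthogonal E" "\<And>b. b \<in> E \<Longrightarrow> norm b = 1" "card E = m"
    and Ev: "\<And>b. b \<in> E \<Longrightarrow> orthogonal b v"
    and sh: "\<And>\<theta> u. sigma_hat X (X *v \<theta> + u) = sqrt ((\<Sum>b\<in>E. (u \<bullet> b)\<^sup>2) / real m)"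
    using least_squares_decomposition[OF rank card, of i] unfolding m_def r_def by metis
  have r: "r > 0" using card by (simp add: r_def)
  show xi_pos: "xi X i > 0" using v r by (simp add: xi)
  \<comment> \<open>The unit vector \<open>w\<close> and the residual directions \<open>E\<close> form an orthonormal system.\<close>
  define w where "w = v /\<^sub>R norm v"
  have w: "norm w = 1" using v by (simp add: w_def)
  have Ew: "orthogonal b w" if "b \<in> E" for b
    using Ev[OF that] by (simp add: w_def orthogonal_def)
  have "w \<notin> E"
    using Ew[of w] w by (auto simp: orthogonal_def norm_eq_1)
  have orth: "pairwise orthogonal (insert w E)"
    using E(1) Ew Ew[THEN orthogonal_commute[THEN iffD1]] by (auto simp: pairwise_insert)
  have norms: "norm b = 1" if "b \<in> insert w E" for b using that w E(2) by auto
  let ?T = "\<lambda>\<omega>. u \<omega> /\<^sub>R \<sigma>" and ?J = "\<lambda>x. (x \<bullet> w, \<Sum>b\<in>E. (x \<bullet> b)\<^sup>2)"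
  have u_meas: "u \<in> borel_measurable M"
    using distributed_measurable[OF u] by simp
  have H: "?H \<in> borel_measurable (borel \<Otimes>\<^sub>M borel)" by measurable
  have J: "?J \<in> borel \<rightarrow>\<^sub>M borel \<Otimes>\<^sub>M borel" by measurable
  have T: "?T \<in> borel_measurable M" using u_meas by measurable
  have "?P = distr std_gaussian (borel \<Otimes>\<^sub>M borel) ?J"
    using joint_law_std_gaussian_coordinate_sum_squares[OF orth norms \<open>w \<notin> E\<close>] by (simp add: E(3))
  also have "\<dots> = distr M (borel \<Otimes>\<^sub>M borel) (?J \<circ> ?T)"
    unfolding distr_scaled_spherical_normal[OF \<sigma> u, symmetric] by (rule distr_distr[OF J T])
  finally have P: "?P = distr M (borel \<Otimes>\<^sub>M borel) (?J \<circ> ?T)" .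
  have "distr ?P borel ?H = distr M borel (?H \<circ> (?J \<circ> ?T))"
    unfolding P by (rule distr_distr[OF H measurable_comp[OF T J]])
  also have "?H \<circ> (?J \<circ> ?T) = (\<lambda>\<omega>. inverse \<sigma> * \<alpha> * (soft_threshold_estimator X \<eta> (X *v \<theta> + u \<omega>) i - \<theta> $ i))"
  proof
    fix \<omega>
    define x where "x = ?T \<omega>"
    define z where "z = x \<bullet> w"
    define V where "V = (\<Sum>b\<in>E. (x \<bullet> b)\<^sup>2)"
    define \<kappa> where "\<kappa> = \<sigma> * norm v"
    define \<tau> where "\<tau> = r * \<theta> $ i / (\<sigma> * \<xi>)"
    have \<kappa>: "\<kappa> > 0" using \<sigma> v by (simp add: \<kappa>_def)
    have ux: "u \<omega> = \<sigma> *\<^sub>R x" using \<sigma> by (simp add: x_def)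
    have vw: "v = norm v *\<^sub>R w" using v by (simp add: w_def)
    have \<theta>: "\<theta> $ i = \<kappa> * \<tau>" using r \<sigma> v by (simp add: \<kappa>_def \<tau>_def \<xi>_def xi)
    have "u \<omega> \<bullet> v = \<kappa> * z"
      by (subst vw) (simp add: ux z_def \<kappa>_def)
    then have ls': "ls_estimator X (X *v \<theta> + u \<omega>) $ i = \<kappa> * (\<tau> + z)"
      by (simp add: ls \<theta> distrib_left)
    have "(\<Sum>b\<in>E. (u \<omega> \<bullet> b)\<^sup>2) = \<sigma>\<^sup>2 * V"
      by (simp add: ux V_def power_mult_distrib sum_distrib_left)
    then have "sigma_hat X (X *v \<theta> + u \<omega>) = \<sigma> * (sqrt V / sqrt (real m))"
      using \<sigma> by (simp add: sh real_sqrt_mult real_sqrt_divide)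
    then have "sigma_hat X (X *v \<theta> + u \<omega>) * xi X i * \<eta> = \<kappa> * (r * \<eta> * (sqrt V / sqrt (real m)))"
      by (simp add: xi \<kappa>_def)
    then have "soft_threshold_estimator X \<eta> (X *v \<theta> + u \<omega>) i
        = soft_threshold (\<kappa> * (r * \<eta> * (sqrt V / sqrt (real m)))) (\<kappa> * (\<tau> + z))"
      by (simp add: soft_threshold_estimator_def soft_threshold_def ls')
    also have "\<dots> = \<kappa> * soft_threshold (r * \<eta> * (sqrt V / sqrt (real m))) (\<tau> + z)"
      by (rule soft_threshold_scale[OF \<kappa>])
    finally have "inverse \<sigma> * \<alpha> * (soft_threshold_estimator X \<eta> (X *v \<theta> + u \<omega>) i - \<theta> $ i)
        = inverse \<sigma> * \<alpha> * (\<kappa> * (soft_threshold (r * \<eta> * (sqrt V / sqrt (real m))) (\<tau> + z) - \<tau>))"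
      by (simp add: \<theta> right_diff_distrib)
    also have "\<dots> = \<alpha> * \<xi> / r * (soft_threshold (r * \<eta> * (sqrt V / sqrt (real m))) (\<tau> + z) - \<tau>)"
      using r \<sigma> by (simp add: \<kappa>_def \<xi>_def xi)
    finally show "(?H \<circ> (?J \<circ> ?T)) \<omega>
        = inverse \<sigma> * \<alpha> * (soft_threshold_estimator X \<eta> (X *v \<theta> + u \<omega>) i - \<theta> $ i)"
      by (simp only: o_def prod.case x_def z_def V_def \<tau>_def)
  qed
  finally show "?L = distr ?P borel ?H" by (rule sym)
qed

theorem proposition24:
  fixes X :: "real ^ 'k ^ 'n" and \<theta> :: "real ^ 'k" and \<sigma> \<eta> \<alpha> :: real and i :: 'k
    and M :: "'a measure" and u Y :: "'a \<Rightarrow> real ^ 'n" and \<mu> :: "real measure"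
    and n m :: nat and \<xi> :: real
  assumes n: "n = CARD('n)" and m: "m = CARD('n) - CARD('k)" and \<xi>: "\<xi> = xi X i"
    and "CARD('k) < CARD('n)" and "rank X = CARD('k)"
    and "\<sigma> > 0" and "\<eta> > 0" and "\<alpha> > 0"
    and "prob_space M"
    and u: "distributed M lborel u (\<lambda>x. ennreal (multivariate_normal_density 0 (mat (\<sigma>\<^sup>2)) x))"
    and Y: "Y = (\<lambda>\<omega>. X *v \<theta> + u \<omega>)"
    and \<mu>: "\<mu> = distr M borel
          (\<lambda>\<omega>. inverse \<sigma> * \<alpha> * (soft_threshold_estimator X \<eta> (Y \<omega>) i - \<theta> $ i))"
  shows
    "(\<forall>x. cdf \<mu> x =
        (LBINT s:{0..}. std_normal_cdf (sqrt n * x / (\<alpha> * \<xi>) + sqrt n * s * \<eta>)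
            * root_chi_square_density m s) * of_bool (x / \<alpha> + \<theta> $ i / \<sigma> \<ge> 0)
      + (LBINT s:{0..}. std_normal_cdf (sqrt n * x / (\<alpha> * \<xi>) - sqrt n * s * \<eta>)
            * root_chi_square_density m s) * of_bool (x / \<alpha> + \<theta> $ i / \<sigma> < 0))
   \<and> (\<forall>x. cdf \<mu> x =
        noncentral_t_cdf m (- sqrt n * x / (\<alpha> * \<xi>)) (sqrt n * \<eta>)
            * of_bool (x / \<alpha> + \<theta> $ i / \<sigma> \<ge> 0)
      + noncentral_t_cdf m (- sqrt n * x / (\<alpha> * \<xi>)) (- sqrt n * \<eta>)
            * of_bool (x / \<alpha> + \<theta> $ i / \<sigma> < 0))
   \<and> (\<forall>A \<in> sets borel. emeasure \<mu> A =
        ennreal (LBINT s:{0..}.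
            (std_normal_cdf (sqrt n * (- \<theta> $ i / (\<sigma> * \<xi>) + s * \<eta>))
             - std_normal_cdf (sqrt n * (- \<theta> $ i / (\<sigma> * \<xi>) - s * \<eta>)))
            * root_chi_square_density m s)
          * emeasure (return borel (- \<alpha> * \<theta> $ i / \<sigma>)) A
      + emeasure (density lborel (\<lambda>x. ennreal (sqrt n * inverse \<alpha> * inverse \<xi> *
            ((LBINT s:{0..}. std_normal_density (sqrt n * x / (\<alpha> * \<xi>) + sqrt n * s * \<eta>)
                  * root_chi_square_density m s) * of_bool (x / \<alpha> + \<theta> $ i / \<sigma> > 0)
           + (LBINT s:{0..}. std_normal_density (sqrt n * x / (\<alpha> * \<xi>) - sqrt n * s * \<eta>)
                  * root_chi_square_density m s) * of_bool (x / \<alpha> + \<theta> $ i / \<sigma> < 0))))) A)"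
proof -
  define d where "d = \<alpha> * \<xi> / sqrt n"
  define a where "a = sqrt n * \<eta>"
  define \<tau> where "\<tau> = sqrt n * \<theta> $ i / (\<sigma> * \<xi>)"
  have n0: "sqrt n > 0" and m0: "m > 0" using assms by auto
  have \<xi>0: "\<xi> > 0"
    unfolding \<xi> using assms by (intro distr_soft_threshold_error(1))
  have d0: "d > 0" and a0: "a > 0" using n0 \<xi>0 assms by (auto simp: d_def a_def)
  have \<mu>': "\<mu> = distr (std_normal_distribution \<Otimes>\<^sub>M chi_square m) borel
      (\<lambda>(z, v). d * (soft_threshold (a * (sqrt v / sqrt (real m))) (\<tau> + z) - \<tau>))"
    unfolding \<mu> Y d_def a_def \<tau>_def n m \<xi>
    using assms by (intro distr_soft_threshold_error(2))
  have xd: "sqrt n * x / (\<alpha> * \<xi>) = x / d" for x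
    using n0 by (simp add: d_def)
  \<comment> \<open>The indicators of the statement become indicators of the sign of \<open>x / d + \<tau>\<close>.\<close>
  have sgn_eq: "x / \<alpha> + \<theta> $ i / \<sigma> = \<xi> / sqrt n * (x / d + \<tau>)" for x
    using n0 \<xi>0 by (simp add: d_def \<tau>_def field_simps)
  have "\<xi> / sqrt n > 0" using \<xi>0 n0 by simp
  then have ge: "x / \<alpha> + \<theta> $ i / \<sigma> \<ge> 0 \<longleftrightarrow> x / d + \<tau> \<ge> 0"
    and gt: "x / \<alpha> + \<theta> $ i / \<sigma> > 0 \<longleftrightarrow> x / d + \<tau> > 0"
    and lt: "x / \<alpha> + \<theta> $ i / \<sigma> < 0 \<longleftrightarrow> x / d + \<tau> < 0" for x
    unfolding sgn_eq by (simp_all only: zero_le_mult_iff zero_less_mult_iff mult_less_0_iff) auto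
  have as: "sqrt n * s * \<eta> = a * s" for s by (simp add: a_def)
  have cdf: "cdf \<mu> x =
      (LBINT s:{0..}. std_normal_cdf (x / d + a * s) * root_chi_square_density m s) * of_bool (x / d + \<tau> \<ge> 0)
      + (LBINT s:{0..}. std_normal_cdf (x / d - a * s) * root_chi_square_density m s) * of_bool (x / d + \<tau> < 0)" for x
    unfolding \<mu>' cdf_soft_threshold_normal_chi_square[OF m0 d0 a0] by (cases "x / d + \<tau> \<ge> 0") auto
  have t_pos: "noncentral_t_cdf m (- sqrt n * x / (\<alpha> * \<xi>)) (sqrt n * \<eta>)
      = (LBINT s:{0..}. std_normal_cdf (x / d + a * s) * root_chi_square_density m s)"
    and t_neg: "noncentral_t_cdf m (- sqrt n * x / (\<alpha> * \<xi>)) (- sqrt n * \<eta>)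
      = (LBINT s:{0..}. std_normal_cdf (x / d - a * s) * root_chi_square_density m s)" for x
    unfolding noncentral_t_cdf_eq_integral[OF m0] xd[symmetric] as[symmetric]
    by (simp_all add: algebra_simps)
  have atom: "sqrt n * (- \<theta> $ i / (\<sigma> * \<xi>) + s * \<eta>) = - \<tau> + a * s"
    "sqrt n * (- \<theta> $ i / (\<sigma> * \<xi>) - s * \<eta>) = - \<tau> - a * s" for s
    by (simp_all add: \<tau>_def a_def algebra_simps)
  have pt: "- \<alpha> * \<theta> $ i / \<sigma> = - d * \<tau>"
    using n0 \<xi>0 by (simp add: d_def \<tau>_def)
  have scale: "sqrt n * inverse \<alpha> * inverse \<xi> = inverse d"
    by (simp add: d_def field_simps)
  show ?thesis
    unfolding xd as ge gt lt t_pos t_neg atom pt scale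
  proof (intro conjI allI ballI)
    show "emeasure \<mu> A =
      ennreal (LBINT s:{0..}. (std_normal_cdf (- \<tau> + a * s) - std_normal_cdf (- \<tau> - a * s))
          * root_chi_square_density m s) * emeasure (return borel (- d * \<tau>)) A
      + emeasure (density lborel (\<lambda>x. ennreal (inverse d *
          ((LBINT s:{0..}. std_normal_density (x / d + a * s) * root_chi_square_density m s) * of_bool (x / d + \<tau> > 0)
          + (LBINT s:{0..}. std_normal_density (x / d - a * s) * root_chi_square_density m s) * of_bool (x / d + \<tau> < 0))))) A"
      if A: "A \<in> sets borel" for A
    proof -
      have "(\<lambda>x. ennreal (inverse d *
          ((LBINT s:{0..}. std_normal_density (x / d + a * s) * root_chi_square_density m s) * of_bool (x / d + \<tau> > 0)
          + (LBINT s:{0..}. std_normal_density (x / d - a * s) * root_chi_square_density m s) * of_bool (x / d + \<tau> < 0))))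
          \<in> borel_measurable lborel"
        unfolding set_lebesgue_integral_def by measurable
      then show ?thesis
        unfolding \<mu>' emeasure_soft_threshold_normal_chi_square[OF m0 d0 a0 A]
        using A by (simp add: emeasure_density)
    qed
  qed (rule cdf)+
qed

end
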